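(* Every finite-dimensional irreducible $\mathcal{A}$-module is isomorphic to exactly one of the $\mathcal{A}$-modules in the following list: the modules of type $B(d)$, where $d$ runs over the nonnegative even integers, and the modules of type $AB(d,n)$, where $d$ runs over the nonnegative integers and $n$ runs over the four symbols $0,x,y,z$.
   Context: $\mathbb{K}$ is an algebraically closed field of characteristic zero. $\mathcal{A}$ is the unital associative $\mathbb{K}$-algebra with generators $x,y,z$ and relations $xy+yx=2z$, $yz+zy=2x$, $zx+xz=2y$. Type $B(d)$ ($d\ge 0$ an even integer): the $\mathcal{A}$-module with basis $\{v_i\}_{i=0}^d$ such that for $0\le i\le d$: $x.v_i=(-1)^i(d-2i)v_i$, $y.v_i=(d-i+1)v_{i-1}+(i+1)v_{i+1}$, $z.v_i=(-1)^{i-1}(d-i+1)v_{i-1}+(-1)^i(i+1)v_{i+1}$, where $v_{-1}=0$ and $v_{d+1}=0$. Type $AB(d,n)$ ($d\ge 0$ an integer, $n\in\{0,x,y,z\}$): for $a\in\{x,y,z\}$ put $\widehat a(n)=1$ if $n\in\{0,a\}$ and $\widehat a(n)=-1$ otherwise. The module has basis $\{v_i\}_{i=0}^d$ such that for $0\le i\le d$: $x.v_i=\widehat x(n)(-1)^{d+i}(2d-2i+1)v_i$, $y.v_i=\widehat y(n)(-1)^d\big((2d-i+2)v_{i-1}+(i+1)v_{i+1}\big)$, $z.v_i=\widehat z(n)\big((-1)^{i-1}(2d-i+2)v_{i-1}+(-1)^i(i+1)v_{i+1}\big)$, where $v_{-1}=0$ and $v_{d+1}=v_d$. All of these formulas define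 irreducible $\mathcal{A}$-modules of dimension $d+1$. A module isomorphic to one of them is said to have the corresponding type. *)

theory Defs
  imports "HOL-Library.Poly_Mapping" "HOL-Computational_Algebra.Polynomial"
begin

section \<open>The algebra\<close>

text \<open>The free algebra on the three generators is the monoid algebra of the monoid of words:
  finitely supported functions on words, with the convolution product.\<close>

datatype gen = Gx | Gy | Gz

datatype word = Word (letters: "gen list")

instantiation word :: monoid_add
begin
definition zero_word :: word where "0 = Word []"
definition plus_word :: "word \<Rightarrow> word \<Rightarrow> word" where "u + v = Word (letters u @ letters v)"
instance by standard (auto simp: zero_word_def plus_word_def)
end

type_synonym 'k free_alg = "word \<Rightarrow>\<^sub>0 'k"

definition free_gen :: "gen \<Rightarrow> 'k::field free_alg" where
  "free_gen g = Poly_Mapping.single (Word [g]) 1"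

definition relators :: "'k::field free_alg set" where
  "relators =
    {free_gen Gx * free_gen Gy + free_gen Gy * free_gen Gx - 2 * free_gen Gz,
     free_gen Gy * free_gen Gz + free_gen Gz * free_gen Gy - 2 * free_gen Gx,
     free_gen Gz * free_gen Gx + free_gen Gx * free_gen Gz - 2 * free_gen Gy}"

text \<open>The two-sided ideal generated by the relators.\<close>

inductive_set rel_ideal :: "'k::field free_alg set" where
  relator: "r \<in> relators \<Longrightarrow> r \<in> rel_ideal"
| zero: "0 \<in> rel_ideal"
| add: "p \<in> rel_ideal \<Longrightarrow> q \<in> rel_ideal \<Longrightarrow> p + q \<in> rel_ideal"
| mult_left: "p \<in> rel_ideal \<Longrightarrow> q * p \<in> rel_ideal"
| mult_right: "p \<in> rel_ideal \<Longrightarrow> p * q \<in> rel_ideal"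

lemma rel_ideal_uminus: "p \<in> rel_ideal \<Longrightarrow> - p \<in> rel_ideal"
  using rel_ideal.mult_left[of p "-1"] by simp

lemma rel_ideal_diff: "p \<in> rel_ideal \<Longrightarrow> q \<in> rel_ideal \<Longrightarrow> p - q \<in> rel_ideal"
  using rel_ideal.add[of p "-q"] rel_ideal_uminus by fastforce

definition rel_cong :: "'k::field free_alg \<Rightarrow> 'k free_alg \<Rightarrow> bool" where
  "rel_cong p q \<longleftrightarrow> p - q \<in> rel_ideal"

lemma equivp_rel_cong: "equivp (rel_cong :: 'k::field free_alg \<Rightarrow> _)"
proof (rule equivpI)
  show "reflp (rel_cong :: 'k free_alg \<Rightarrow> _)"
    by (rule reflpI) (simp add: rel_cong_def rel_ideal.zero)
  show "symp (rel_cong :: 'k free_alg \<Rightarrow> _)"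
    by (rule sympI) (metis rel_cong_def rel_ideal_uminus minus_diff_eq)
  show "transp (rel_cong :: 'k free_alg \<Rightarrow> _)"
  proof (rule transpI)
    fix p q r :: "'k free_alg"
    assume "rel_cong p q" "rel_cong q r"
    moreover have "p - r = (p - q) + (q - r)"
      by simp
    ultimately show "rel_cong p r"
      unfolding rel_cong_def by (simp only: rel_ideal.add)
  qed
qed

quotient_type (overloaded) 'k alg = "'k::field free_alg" / rel_cong
  by (rule equivp_rel_cong)

lemma poly_mapping_induct_monomial:
  fixes p :: "'a \<Rightarrow>\<^sub>0 'b::comm_monoid_add"
  assumes "\<And>k c. P (Poly_Mapping.single k c)" and "\<And>p q. P p \<Longrightarrow> P q \<Longrightarrow> P (p + q)"
  shows "P p"
proof (induction p rule: update_induct)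
  case const
  from assms(1)[of undefined 0] show ?case by simp
next
  case (update f a b)
  have "Poly_Mapping.update a b f = f + Poly_Mapping.single a b"
    using update(1)
    by (intro poly_mapping_eqI) (auto simp: lookup_update lookup_add lookup_single in_keys_iff)
  with assms update(3) show ?case by simp
qed

lemma word_add_eq_0_iff: "u + v = (0 :: word) \<longleftrightarrow> u = 0 \<and> v = 0"
  by (cases u; cases v) (auto simp: plus_word_def zero_word_def)

lemma const_coeff_mult:
  fixes p q :: "'k::field free_alg"
  shows "Poly_Mapping.lookup (p * q) 0 = Poly_Mapping.lookup p 0 * Poly_Mapping.lookup q 0"
proof (induction p rule: poly_mapping_induct_monomial)
  case (1 u c)
  show ?case
    by (induction q rule: poly_mapping_induct_monomial)
      (auto simp: mult_single lookup_single lookup_add word_add_eq_0_iff distrib_left when_def)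
qed (simp add: lookup_add distrib_right)

lemma const_coeff_free_gen: "Poly_Mapping.lookup (free_gen g) 0 = 0"
  by (simp add: free_gen_def lookup_single zero_word_def)

lemma const_coeff_rel_ideal: "p \<in> rel_ideal \<Longrightarrow> Poly_Mapping.lookup p 0 = 0"
  by (induction rule: rel_ideal.induct)
    (auto simp: relators_def lookup_add lookup_minus const_coeff_mult const_coeff_free_gen)

instantiation alg :: (field) ring_1
begin

lift_definition zero_alg :: "'a alg" is 0 .
lift_definition one_alg :: "'a alg" is 1 .
lift_definition plus_alg :: "'a alg \<Rightarrow> 'a alg \<Rightarrow> 'a alg" is "(+)"
  proof -
  fix p p' q q' :: "'a free_alg"
  assume "rel_cong p p'" "rel_cong q q'"
  moreover have "p + q - (p' + q') = (p - p') + (q - q')"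
    by (simp add: algebra_simps)
  ultimately show "rel_cong (p + q) (p' + q')"
    unfolding rel_cong_def by (simp only: rel_ideal.add)
qed
lift_definition uminus_alg :: "'a alg \<Rightarrow> 'a alg" is uminus
  proof -
  fix p p' :: "'a free_alg"
  assume "rel_cong p p'"
  moreover have "- p - - p' = - (p - p')"
    by simp
  ultimately show "rel_cong (- p) (- p')"
    unfolding rel_cong_def by (simp only: rel_ideal_uminus)
qed
lift_definition minus_alg :: "'a alg \<Rightarrow> 'a alg \<Rightarrow> 'a alg" is "(-)"
  proof -
  fix p p' q q' :: "'a free_alg"
  assume "rel_cong p p'" "rel_cong q q'"
  moreover have "p - q - (p' - q') = (p - p') - (q - q')"
    by (simp add: algebra_simps)
  ultimately show "rel_cong (p - q) (p' - q')"
    unfolding rel_cong_def by (simp only: rel_ideal_diff)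
qed
lift_definition times_alg :: "'a alg \<Rightarrow> 'a alg \<Rightarrow> 'a alg" is "(*)"
proof -
  fix p p' q q' :: "'a free_alg"
  assume "rel_cong p p'" "rel_cong q q'"
  moreover have "p * q - p' * q' = p * (q - q') + (p - p') * q'"
    by (simp add: algebra_simps)
  ultimately show "rel_cong (p * q) (p' * q')"
    unfolding rel_cong_def by (simp only: rel_ideal.add rel_ideal.mult_left rel_ideal.mult_right)
qed

instance
proof
  fix a b c :: "'a alg"
  show "a + b + c = a + (b + c)"
    by transfer (simp add: rel_cong_def rel_ideal.zero algebra_simps)
  show "a + b = b + a"
    by transfer (simp add: rel_cong_def rel_ideal.zero algebra_simps)
  show "0 + a = a"
    by transfer (simp add: rel_cong_def rel_ideal.zero)
  show "- a + a = 0"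
    by transfer (simp add: rel_cong_def rel_ideal.zero)
  show "a - b = a + - b"
    by transfer (simp add: rel_cong_def rel_ideal.zero)
  show "a * b * c = a * (b * c)"
    by transfer (simp add: rel_cong_def rel_ideal.zero algebra_simps)
  show "1 * a = a"
    by transfer (simp add: rel_cong_def rel_ideal.zero)
  show "a * 1 = a"
    by transfer (simp add: rel_cong_def rel_ideal.zero)
  show "(a + b) * c = a * c + b * c"
    by transfer (simp add: rel_cong_def rel_ideal.zero algebra_simps)
  show "a * (b + c) = a * b + a * c"
    by transfer (simp add: rel_cong_def rel_ideal.zero algebra_simps)
  show "(0 :: 'a alg) \<noteq> 1"
  proof transfer
    show "\<not> rel_cong (0 :: 'a free_alg) 1"
    proof
      assume "rel_cong (0 :: 'a free_alg) 1"
      then have "Poly_Mapping.lookup (0 - 1 :: 'a free_alg) 0 = 0"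
        unfolding rel_cong_def by (rule const_coeff_rel_ideal)
      then show False by (simp add: lookup_minus lookup_one)
    qed
  qed
qed

end

lift_definition gen_alg :: "gen \<Rightarrow> 'k::field alg" is free_gen .

lift_definition scalar :: "'k::field \<Rightarrow> 'k alg" is "\<lambda>c. Poly_Mapping.single 0 c" .

lemma rep_alg_cong: "rel_cong (rep_alg (abs_alg p)) p"
  by (rule rep_abs_rsp_left[OF Quotient3_alg]) (simp add: rel_cong_def rel_ideal.zero)

lemma gen_alg_relations:
  "gen_alg Gx * gen_alg Gy + gen_alg Gy * gen_alg Gx = 2 * (gen_alg Gz :: 'k::field alg)"
  "gen_alg Gy * gen_alg Gz + gen_alg Gz * gen_alg Gy = 2 * (gen_alg Gx :: 'k::field alg)"
  "gen_alg Gz * gen_alg Gx + gen_alg Gx * gen_alg Gz = 2 * (gen_alg Gy :: 'k::field alg)"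
  unfolding mult_2
  by (transfer; unfold rel_cong_def; rule rel_ideal.relator; simp add: relators_def mult_2)+


section \<open>Modules\<close>

locale left_module =
  fixes V :: "'v::ab_group_add set" and act :: "'r::ring_1 \<Rightarrow> 'v \<Rightarrow> 'v"
  assumes zero_closed: "0 \<in> V"
    and add_closed: "u \<in> V \<Longrightarrow> v \<in> V \<Longrightarrow> u + v \<in> V"
    and act_closed: "u \<in> V \<Longrightarrow> act a u \<in> V"
    and act_add_right: "u \<in> V \<Longrightarrow> v \<in> V \<Longrightarrow> act a (u + v) = act a u + act a v"
    and act_add_left: "u \<in> V \<Longrightarrow> act (a + b) u = act a u + act b u"
    and act_mult: "u \<in> V \<Longrightarrow> act (a * b) u = act a (act b u)"
    and act_one: "u \<in> V \<Longrightarrow> act 1 u = u"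

text \<open>Closure under additive inverses is automatic, since \<open>-1\<close> acts as negation.\<close>

definition left_submodule ::
    "'v::ab_group_add set \<Rightarrow> 'v set \<Rightarrow> ('r::ring_1 \<Rightarrow> 'v \<Rightarrow> 'v) \<Rightarrow> bool" where
  "left_submodule U V act \<longleftrightarrow> U \<subseteq> V \<and> 0 \<in> U \<and>
     (\<forall>u\<in>U. \<forall>v\<in>U. u + v \<in> U) \<and> (\<forall>a. \<forall>u\<in>U. act a u \<in> U)"

definition irreducible_module ::
    "'v::ab_group_add set \<Rightarrow> ('r::ring_1 \<Rightarrow> 'v \<Rightarrow> 'v) \<Rightarrow> bool" where
  "irreducible_module V act \<longleftrightarrow> left_module V act \<and> V \<noteq> {0} \<and>
     (\<forall>U. left_submodule U V act \<longrightarrow> U = {0} \<or> U = V)"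

definition finite_dimensional_module ::
    "'v::ab_group_add set \<Rightarrow> ('k::field alg \<Rightarrow> 'v \<Rightarrow> 'v) \<Rightarrow> bool" where
  "finite_dimensional_module V act \<longleftrightarrow>
     (\<exists>S. finite S \<and> S \<subseteq> V \<and> (\<forall>v\<in>V. \<exists>c. v = (\<Sum>s\<in>S. act (scalar (c s)) s)))"

definition module_isomorphic ::
    "'v::ab_group_add set \<Rightarrow> ('r::ring_1 \<Rightarrow> 'v \<Rightarrow> 'v) \<Rightarrow>
     'w::ab_group_add set \<Rightarrow> ('r \<Rightarrow> 'w \<Rightarrow> 'w) \<Rightarrow> bool" where
  "module_isomorphic V act W act' \<longleftrightarrow>
     (\<exists>f. bij_betw f V W \<and> (\<forall>u\<in>V. \<forall>v\<in>V. f (u + v) = f u + f v) \<and>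
          (\<forall>a. \<forall>u\<in>V. f (act a u) = act' a (f u)))"


section \<open>Modules given by operators on a basis\<close>

text \<open>All modules of the list live in the space \<open>nat \<Rightarrow>\<^sub>0 'k\<close> with basis
  \<open>e\<^sub>i = Poly_Mapping.single i 1\<close>; the underlying space of a module of dimension \<open>d + 1\<close> is the span
  of \<open>e\<^sub>0, \<dots>, e\<^sub>d\<close>.\<close>

type_synonym 'k vec = "nat \<Rightarrow>\<^sub>0 'k"

definition basis_vec :: "nat \<Rightarrow> 'k::field vec" where
  "basis_vec i = Poly_Mapping.single i 1"

definition vscale :: "'k::field \<Rightarrow> 'k vec \<Rightarrow> 'k vec" where
  "vscale c u = Poly_Mapping.map ((*) c) u"

definition vec_space :: "nat \<Rightarrow> 'k::field vec set" where
  "vec_space d = {u. Poly_Mapping.keys u \<subseteq> {..d}}"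

text \<open>The linear map sending \<open>e\<^sub>i\<close> to \<open>b i\<close> for \<open>i \<le> d\<close>.\<close>

definition linear_ext :: "nat \<Rightarrow> (nat \<Rightarrow> 'k::field vec) \<Rightarrow> 'k vec \<Rightarrow> 'k vec" where
  "linear_ext d b u = (\<Sum>i\<le>d. vscale (Poly_Mapping.lookup u i) (b i))"

definition word_act :: "(gen \<Rightarrow> 'k::field vec \<Rightarrow> 'k vec) \<Rightarrow> word \<Rightarrow> 'k vec \<Rightarrow> 'k vec" where
  "word_act T w u = foldr T (letters w) u"

definition free_act :: "(gen \<Rightarrow> 'k::field vec \<Rightarrow> 'k vec) \<Rightarrow> 'k free_alg \<Rightarrow> 'k vec \<Rightarrow> 'k vec" where
  "free_act T p u = (\<Sum>w\<in>Poly_Mapping.keys p. vscale (Poly_Mapping.lookup p w) (word_act T w u))"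

text \<open>The action in which the generator \<open>g\<close> acts as the linear operator \<open>T g\<close>. It does not depend
  on the representative chosen by \<open>rep_alg\<close> when the operators \<open>T g\<close> satisfy the defining relations;
  see \<open>alg_act_abs\<close> below.\<close>

definition alg_act :: "(gen \<Rightarrow> 'k::field vec \<Rightarrow> 'k vec) \<Rightarrow> 'k alg \<Rightarrow> 'k vec \<Rightarrow> 'k vec" where
  "alg_act T a u = free_act T (rep_alg a) u"


section \<open>The modules of type B and AB\<close>

text \<open>The vectors \<open>v\<^sub>j\<close> for \<open>-1 \<le> j \<le> d + 1\<close>; the two families differ in the convention for
  \<open>v\<^sub>d\<^sub>+\<^sub>1\<close>.\<close>

definition vec_B :: "nat \<Rightarrow> int \<Rightarrow> 'k::field vec" where
  "vec_B d j = (if 0 \<le> j \<and> j \<le> int d then basis_vec (nat j) else 0)"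

definition vec_AB :: "nat \<Rightarrow> int \<Rightarrow> 'k::field vec" where
  "vec_AB d j = (if j = int d + 1 then basis_vec d else vec_B d j)"

fun image_B :: "nat \<Rightarrow> gen \<Rightarrow> nat \<Rightarrow> 'k::field vec" where
  "image_B d Gx i = vscale ((-1) ^ i * (of_nat d - 2 * of_nat i)) (vec_B d (int i))"
| "image_B d Gy i = vscale (of_nat d - of_nat i + 1) (vec_B d (int i - 1))
                  + vscale (of_nat i + 1) (vec_B d (int i + 1))"
| "image_B d Gz i = vscale ((-1) powi (int i - 1) * (of_nat d - of_nat i + 1)) (vec_B d (int i - 1))
                  + vscale ((-1) ^ i * (of_nat i + 1)) (vec_B d (int i + 1))"

text \<open>The label \<open>n \<in> {0, x, y, z}\<close> is an element of \<open>gen option\<close>, with \<open>None\<close> for \<open>0\<close>.\<close>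

definition label_sign :: "gen \<Rightarrow> gen option \<Rightarrow> 'k::field" where
  "label_sign a n = (if n \<in> {None, Some a} then 1 else -1)"

fun image_AB :: "nat \<Rightarrow> gen option \<Rightarrow> gen \<Rightarrow> nat \<Rightarrow> 'k::field vec" where
  "image_AB d n Gx i =
     vscale (label_sign Gx n * (-1) ^ (d + i) * (2 * of_nat d - 2 * of_nat i + 1)) (vec_AB d (int i))"
| "image_AB d n Gy i = vscale (label_sign Gy n * (-1) ^ d)
     (vscale (2 * of_nat d - of_nat i + 2) (vec_AB d (int i - 1))
      + vscale (of_nat i + 1) (vec_AB d (int i + 1)))"
| "image_AB d n Gz i = vscale (label_sign Gz n)
     (vscale ((-1) powi (int i - 1) * (2 * of_nat d - of_nat i + 2)) (vec_AB d (int i - 1))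
      + vscale ((-1) ^ i * (of_nat i + 1)) (vec_AB d (int i + 1)))"

datatype module_type = TypeB nat | TypeAB nat "gen option"

definition listed_types :: "module_type set" where
  "listed_types = {TypeB d | d. even d} \<union> {TypeAB d n | d n. True}"

fun type_space :: "module_type \<Rightarrow> 'k::field vec set" where
  "type_space (TypeB d) = vec_space d"
| "type_space (TypeAB d n) = vec_space d"

fun type_act :: "module_type \<Rightarrow> 'k::field alg \<Rightarrow> 'k vec \<Rightarrow> 'k vec" where
  "type_act (TypeB d) = alg_act (\<lambda>g. linear_ext d (image_B d g))"
| "type_act (TypeAB d n) = alg_act (\<lambda>g. linear_ext d (image_AB d n g))"


section \<open>Well-definedness of the listed modules\<close>

lemma lookup_vscale [simp]: "Poly_Mapping.lookup (vscale c u) i = c * Poly_Mapping.lookup u i"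
  unfolding vscale_def by transfer (simp add: when_def)

lemma vscale_simps:
  "vscale c (u + v) = vscale c u + vscale c v"
  "vscale (a + b) u = vscale a u + vscale b u"
  "vscale a (vscale b u) = vscale (a * b) u"
  "vscale 1 u = u" "vscale 0 u = 0" "vscale c 0 = 0"
  by (rule poly_mapping_eqI; simp add: lookup_add algebra_simps)+

lemma vscale_sum: "vscale c (\<Sum>i\<in>A. f i) = (\<Sum>i\<in>A. vscale c (f i))"
  by (induction A rule: infinite_finite_induct) (auto simp: vscale_simps)

lemma linear_ext_add: "linear_ext d b (u + v) = linear_ext d b u + linear_ext d b v"
  by (simp add: linear_ext_def lookup_add vscale_simps sum.distrib)

lemma linear_ext_vscale: "linear_ext d b (vscale c u) = vscale c (linear_ext d b u)"
  by (simp add: linear_ext_def vscale_sum vscale_simps)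

lemma linear_ext_zero: "linear_ext d b 0 = 0"
  by (simp add: linear_ext_def vscale_simps)

lemma linear_ext_basis: "i \<le> d \<Longrightarrow> linear_ext d b (basis_vec i) = b i"
  by (simp add: linear_ext_def basis_vec_def lookup_single when_def vscale_simps
      if_distrib[of "\<lambda>c. vscale c _"] cong: if_cong)

lemma linear_ext_sum: "linear_ext d b (\<Sum>i\<in>A. f i) = (\<Sum>i\<in>A. linear_ext d b (f i))"
  by (induction A rule: infinite_finite_induct) (auto simp: linear_ext_add linear_ext_zero)

lemma space_add: "u \<in> vec_space d \<Longrightarrow> v \<in> vec_space d \<Longrightarrow> u + v \<in> vec_space d"
  unfolding vec_space_def using Poly_Mapping.keys_add[of u v] by blast

lemma space_vscale: "u \<in> vec_space d \<Longrightarrow> vscale c u \<in> vec_space d"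
  unfolding vec_space_def by (auto simp: in_keys_iff subset_iff)

lemma space_zero: "0 \<in> vec_space d"
  by (simp add: vec_space_def)

lemma space_sum: "(\<And>i. i \<in> A \<Longrightarrow> f i \<in> vec_space d) \<Longrightarrow> (\<Sum>i\<in>A. f i) \<in> vec_space d"
  by (induction A rule: infinite_finite_induct) (auto simp: space_zero space_add)

locale operator_images =
  fixes d :: nat and img :: "gen \<Rightarrow> nat \<Rightarrow> 'k::field vec"
  assumes img_closed: "i \<le> d \<Longrightarrow> img g i \<in> vec_space d"
    and rel_xy: "i \<le> d \<Longrightarrow>
      linear_ext d (img Gx) (img Gy i) + linear_ext d (img Gy) (img Gx i) = vscale 2 (img Gz i)"
    and rel_yz: "i \<le> d \<Longrightarrow>
      linear_ext d (img Gy) (img Gz i) + linear_ext d (img Gz) (img Gy i) = vscale 2 (img Gx i)"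
    and rel_zx: "i \<le> d \<Longrightarrow>
      linear_ext d (img Gz) (img Gx i) + linear_ext d (img Gx) (img Gz i) = vscale 2 (img Gy i)"
begin

definition T :: "gen \<Rightarrow> 'k vec \<Rightarrow> 'k vec" where "T g = linear_ext d (img g)"

lemma word_act_add: "word_act T w (u + v) = word_act T w u + word_act T w v"
proof -
  have "foldr T gs (u + v) = foldr T gs u + foldr T gs v" for gs
    by (induction gs) (auto simp: T_def linear_ext_add)
  then show ?thesis by (simp add: word_act_def)
qed

lemma word_act_vscale: "word_act T w (vscale c u) = vscale c (word_act T w u)"
proof -
  have "foldr T gs (vscale c u) = vscale c (foldr T gs u)" for gs
    by (induction gs) (auto simp: T_def linear_ext_vscale)
  then show ?thesis by (simp add: word_act_def)
qed

lemma word_act_plus: "word_act T (w + w') u = word_act T w (word_act T w' u)"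
  by (simp add: word_act_def plus_word_def)

lemma word_act_closed: "u \<in> vec_space d \<Longrightarrow> word_act T w u \<in> vec_space d"
proof -
  assume "u \<in> vec_space d"
  then have "foldr T gs u \<in> vec_space d" for gs
    by (induction gs) (auto simp: T_def linear_ext_def intro!: space_sum space_vscale img_closed)
  then show ?thesis by (simp add: word_act_def)
qed

lemma free_act_single: "free_act T (Poly_Mapping.single w c) u = vscale c (word_act T w u)"
  by (auto simp: free_act_def vscale_simps)

lemma free_act_superset:
  "finite A \<Longrightarrow> Poly_Mapping.keys p \<subseteq> A \<Longrightarrow>
   free_act T p u = (\<Sum>w\<in>A. vscale (Poly_Mapping.lookup p w) (word_act T w u))"
  unfolding free_act_def
  by (intro sum.mono_neutral_left) (auto simp: in_keys_iff vscale_simps)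

lemma free_act_plus: "free_act T (p + q) u = free_act T p u + free_act T q u"
proof -
  let ?A = "Poly_Mapping.keys p \<union> Poly_Mapping.keys q"
  have "finite ?A" by simp
  moreover have "Poly_Mapping.keys (p + q) \<subseteq> ?A" by (rule Poly_Mapping.keys_add)
  ultimately show ?thesis
    by (simp add: free_act_superset[of ?A] lookup_add vscale_simps sum.distrib)
qed

lemma free_act_add: "free_act T p (u + v) = free_act T p u + free_act T p v"
  by (simp add: free_act_def word_act_add vscale_simps sum.distrib)

lemma free_act_mult: "free_act T (p * q) u = free_act T p (free_act T q u)"
proof (induction p rule: poly_mapping_induct_monomial)
  case (1 w c)
  show ?case
  proof (induction q rule: poly_mapping_induct_monomial)
    case (1 w' c')
    show ?case
      by (simp add: mult_single free_act_single word_act_plus word_act_vscale vscale_simps)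
  next
    case (2 q q')
    then show ?case by (simp add: distrib_left free_act_plus free_act_add)
  qed
next
  case (2 p p')
  then show ?case by (simp add: distrib_right free_act_plus)
qed

lemma free_act_zero: "free_act T 0 u = 0"
  by (simp add: free_act_def)

lemma free_act_zero_right: "free_act T p 0 = 0"
  using free_act_add[of p 0 0] by (simp only: add_0_right add_cancel_right_right)

lemma free_act_one: "free_act T 1 u = u"
  unfolding single_one[symmetric] free_act_single
  by (simp add: word_act_def zero_word_def vscale_simps)

lemma free_act_uminus: "free_act T (- p) u = - free_act T p u"
  using free_act_plus[of p "-p" u] by (simp add: free_act_zero eq_neg_iff_add_eq_0 add.commute)

lemma free_act_diff: "free_act T (p - q) u = free_act T p u - free_act T q u"
  using free_act_plus[of p "-q" u] by (simp add: free_act_uminus)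

lemma free_act_gen: "free_act T (free_gen g) u = T g u"
  by (simp add: free_gen_def free_act_single word_act_def vscale_simps)

lemma relation_ext:
  assumes "\<And>i. i \<le> d \<Longrightarrow>
    linear_ext d (img f) (img g i) + linear_ext d (img g) (img f i) = vscale 2 (img h i)"
  shows "T f (T g u) + T g (T f u) = T h u + T h u"
proof -
  have "T f (T g u) + T g (T f u) = (\<Sum>i\<le>d. vscale (Poly_Mapping.lookup u i)
      (linear_ext d (img f) (img g i) + linear_ext d (img g) (img f i)))"
    unfolding T_def linear_ext_def[of d "img g" u] linear_ext_def[of d "img f" u]
    by (simp add: linear_ext_sum linear_ext_vscale vscale_simps sum.distrib)
  also have "\<dots> = (\<Sum>i\<le>d. vscale (Poly_Mapping.lookup u i) (vscale (1 + 1) (img h i)))"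
    using assms by simp
  also have "\<dots> = T h u + T h u"
    unfolding T_def linear_ext_def
    by (simp only: vscale_simps distrib_left mult_1_right sum.distrib)
  finally show ?thesis .
qed

lemma free_act_relator: "r \<in> relators \<Longrightarrow> free_act T r u = 0"
  using relation_ext[OF rel_xy, of u] relation_ext[OF rel_yz, of u] relation_ext[OF rel_zx, of u]
  unfolding relators_def mult_2
  by (auto simp only: insert_iff empty_iff free_act_plus free_act_diff free_act_mult free_act_gen
      diff_self)

lemma free_act_rel_ideal: "p \<in> rel_ideal \<Longrightarrow> free_act T p u = 0"
  by (induction arbitrary: u rule: rel_ideal.induct)
    (auto simp: free_act_relator free_act_plus free_act_mult free_act_zero free_act_zero_right)

lemma alg_act_abs: "alg_act T (abs_alg p) u = free_act T p u"
  using rep_alg_cong[of p] free_act_rel_ideal[of "rep_alg (abs_alg p) - p" u]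
  by (simp add: alg_act_def rel_cong_def free_act_diff)

lemma abs_alg_cases: obtains p where "a = abs_alg p"
  using Quotient3_abs_rep[OF Quotient3_alg] by metis

lemma left_module_vec_space: "left_module (vec_space d) (alg_act T)"
proof
  fix u v :: "'k vec" and a b :: "'k alg"
  obtain p q where ab: "a = abs_alg p" "b = abs_alg q" by (meson abs_alg_cases)
  show "0 \<in> vec_space d" by (rule space_zero)
  show "u + v \<in> vec_space d" if "u \<in> vec_space d" "v \<in> vec_space d" using that by (rule space_add)
  show "alg_act T a u \<in> vec_space d" if "u \<in> vec_space d"
    unfolding alg_act_def free_act_def
    using that by (intro space_sum space_vscale word_act_closed)
  show "alg_act T a (u + v) = alg_act T a u + alg_act T a v"
    by (simp add: alg_act_def free_act_add)
  show "alg_act T (a + b) u = alg_act T a u + alg_act T b u"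
    by (simp add: ab plus_alg.abs_eq alg_act_abs free_act_plus)
  show "alg_act T (a * b) u = alg_act T a (alg_act T b u)"
    by (simp add: ab times_alg.abs_eq alg_act_abs free_act_mult)
  show "alg_act T 1 u = u"
    by (simp add: one_alg.abs_eq alg_act_abs free_act_one)
qed

lemma alg_act_gen: "i \<le> d \<Longrightarrow> alg_act T (gen_alg g) (basis_vec i) = img g i"
  by (simp add: gen_alg.abs_eq alg_act_abs free_act_gen T_def linear_ext_basis)

lemma alg_act_scalar: "alg_act T (scalar c) u = vscale c u"
  by (simp add: scalar.abs_eq alg_act_abs free_act_single word_act_def zero_word_def)

end

lemma vec_B_closed: "vec_B d j \<in> vec_space d"
  by (auto simp: vec_B_def vec_space_def basis_vec_def)

lemma vec_AB_closed: "vec_AB d j \<in> vec_space d"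
  using vec_B_closed[of d j] by (auto simp: vec_AB_def vec_space_def basis_vec_def)

lemma minus_one_powi:
  "(-1 :: 'k::field) powi (int i - 1) = - ((-1) ^ i)"
  "(-1 :: 'k::field) powi (1 + int i) = - ((-1) ^ i)"
  by (simp_all add: power_int_diff power_int_add)

lemma lookup_vec_B:
  "Poly_Mapping.lookup (vec_B d j :: 'k::field vec) k = (if j = int k \<and> k \<le> d then 1 else 0)"
  by (auto simp: vec_B_def basis_vec_def lookup_single when_def)

lemma lookup_vec_AB:
  "Poly_Mapping.lookup (vec_AB d j :: 'k::field vec) k =
     (if j = int d + 1 then (if k = d then 1 else 0) else if j = int k \<and> k \<le> d then 1 else 0)"
  by (auto simp: vec_AB_def lookup_vec_B basis_vec_def lookup_single when_def)

lemma linear_ext_vec_B: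
  "linear_ext d b (vec_B d j) = (if 0 \<le> j \<and> j \<le> int d then b (nat j) else 0)"
  by (simp add: vec_B_def linear_ext_basis linear_ext_zero nat_le_iff)

lemma linear_ext_vec_AB:
  "linear_ext d b (vec_AB d j) =
     (if j = int d + 1 then b d else if 0 \<le> j \<and> j \<le> int d then b (nat j) else 0)"
  by (simp add: vec_AB_def linear_ext_vec_B linear_ext_basis)

lemma minus_one_power_square:
  "(-1) ^ m * (-1) ^ m = (1 :: 'k::field)" "(-1) ^ m * ((-1) ^ m * c) = (c :: 'k::field)"
  by (cases "even m"; simp)+

lemma label_sign_simps:
  "label_sign Gz n = label_sign Gx n * label_sign Gy n"
  "label_sign g n * label_sign g n = (1 :: 'k::field)"
  "label_sign g n * (label_sign g n * c) = (c :: 'k::field)"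
  by (cases n; auto simp: label_sign_def; metis gen.exhaust)+

lemma int_eq_simps: "1 + int m = int k \<longleftrightarrow> k = Suc m" "int m + 2 = int k \<longleftrightarrow> k = Suc (Suc m)"
  "nat (int m + 2) = Suc (Suc m)" "nat (1 + int m) = Suc m"
  by auto

lemma index_cases:
  fixes i d :: nat
  assumes "i \<le> d"
  obtains "i = 0" "d = 0" | e where "i = 0" "d = Suc e" | m where "i = Suc m" "d = Suc m"
    | m e where "i = Suc m" "d = Suc (Suc (m + e))"
proof -
  obtain e where "d = i + e" using assms le_Suc_ex by blast
  then show thesis using that by (cases i; cases e) auto
qed

lemmas image_simps = linear_ext_add linear_ext_vscale linear_ext_zero linear_ext_vec_B
  linear_ext_vec_AB lookup_add lookup_vec_B lookup_vec_AB minus_one_powi int_eq_simps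
  vscale_simps(5,6)

lemma operator_images_B:
  "operator_images d (image_B d :: gen \<Rightarrow> nat \<Rightarrow> 'k::field vec)"
proof
  fix i assume i: "i \<le> d"
  show "image_B d g i \<in> (vec_space d :: 'k vec set)" for g
    by (cases g) (auto intro!: space_add space_vscale vec_B_closed)
  show "linear_ext d (image_B d Gx) (image_B d Gy i) + linear_ext d (image_B d Gy) (image_B d Gx i)
      = (vscale 2 (image_B d Gz i) :: 'k vec)"
    using i by (cases rule: index_cases; intro poly_mapping_eqI)
      (auto simp: image_simps algebra_simps)
  show "linear_ext d (image_B d Gy) (image_B d Gz i) + linear_ext d (image_B d Gz) (image_B d Gy i)
      = (vscale 2 (image_B d Gx i) :: 'k vec)"
    using i by (cases rule: index_cases; intro poly_mapping_eqI)
      (auto simp: image_simps algebra_simps)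
  show "linear_ext d (image_B d Gz) (image_B d Gx i) + linear_ext d (image_B d Gx) (image_B d Gz i)
      = (vscale 2 (image_B d Gy i) :: 'k vec)"
    using i by (cases rule: index_cases; intro poly_mapping_eqI)
      (auto simp: image_simps algebra_simps)
qed

lemma operator_images_AB:
  "operator_images d (image_AB d n :: gen \<Rightarrow> nat \<Rightarrow> 'k::field vec)"
proof
  fix i assume i: "i \<le> d"
  show "image_AB d n g i \<in> (vec_space d :: 'k vec set)" for g
    by (cases g) (auto intro!: space_add space_vscale vec_AB_closed)
  show "linear_ext d (image_AB d n Gx) (image_AB d n Gy i)
      + linear_ext d (image_AB d n Gy) (image_AB d n Gx i) = (vscale 2 (image_AB d n Gz i) :: 'k vec)"
    using i by (cases rule: index_cases; intro poly_mapping_eqI)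
      (auto simp: image_simps label_sign_simps minus_one_power_square power_add algebra_simps)
  show "linear_ext d (image_AB d n Gy) (image_AB d n Gz i)
      + linear_ext d (image_AB d n Gz) (image_AB d n Gy i) = (vscale 2 (image_AB d n Gx i) :: 'k vec)"
    using i by (cases rule: index_cases; intro poly_mapping_eqI)
      (auto simp: image_simps label_sign_simps minus_one_power_square power_add algebra_simps)
  show "linear_ext d (image_AB d n Gz) (image_AB d n Gx i)
      + linear_ext d (image_AB d n Gx) (image_AB d n Gz i) = (vscale 2 (image_AB d n Gy i) :: 'k vec)"
    using i by (cases rule: index_cases; intro poly_mapping_eqI)
      (auto simp: image_simps label_sign_simps minus_one_power_square power_add algebra_simps)
qed

lemma type_act_eq_T:
  "type_act (TypeB d) = alg_act (operator_images.T d (image_B d :: gen \<Rightarrow> nat \<Rightarrow> 'k::field vec))"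
  "type_act (TypeAB d n) = alg_act (operator_images.T d (image_AB d n :: gen \<Rightarrow> nat \<Rightarrow> 'k::field vec))"
  unfolding type_act.simps
    operator_images.T_def[OF operator_images_B, abs_def]
    operator_images.T_def[OF operator_images_AB, abs_def]
  by (rule refl)+

lemma left_module_type: "left_module (type_space t :: 'k::field vec set) (type_act t)"
  by (cases t; simp only: type_space.simps type_act_eq_T
      operator_images.left_module_vec_space[OF operator_images_B]
      operator_images.left_module_vec_space[OF operator_images_AB])

lemma type_act_gen:
  assumes "i \<le> d"
  shows "type_act (TypeB d) (gen_alg g) (basis_vec i) = image_B d g i"
    and "type_act (TypeAB d n) (gen_alg g) (basis_vec i) = image_AB d n g i"
  unfolding type_act_eq_T
  using operator_images.alg_act_gen[OF operator_images_B assms]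
    operator_images.alg_act_gen[OF operator_images_AB assms] by blast+

lemma type_act_scalar: "type_act t (scalar c) u = vscale c u"
  by (cases t; simp only: type_act_eq_T
      operator_images.alg_act_scalar[OF operator_images_B]
      operator_images.alg_act_scalar[OF operator_images_AB])

end

theory Submission
  imports Defs
begin

text \<open>Put \<open>D\<^sub>i = y + (-1)\<^sup>i z\<close>. The relations say that \<open>D\<^sub>i\<close> maps an eigenvector of \<open>x\<close> with eigenvalue
  \<open>(-1)\<^sup>i c\<close> to one with eigenvalue \<open>(-1)\<^sup>i\<^sup>+\<^sup>1 (c - 2)\<close>, and that \<open>D\<^sub>i\<^sup>2 - D\<^sub>i\<^sub>+\<^sub>1\<^sup>2 = 4 (-1)\<^sup>i x\<close>. Since a
  finite-dimensional module carries only finitely many eigenvalues, some eigenvector \<open>v\<^sub>0\<close> is killed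
  by \<open>y - z\<close> or \<open>y + z\<close>; the second case reduces to the first by changing the signs of \<open>x\<close> and
  \<open>z\<close>. Applying \<open>D\<^sub>0, D\<^sub>1, \<dots>\<close> to \<open>v\<^sub>0\<close> gives \<open>v\<^sub>0, \<dots>, v\<^sub>N\<close> satisfying the relations of \<open>B(N)\<close>, where
  \<open>N\<close> is the eigenvalue of \<open>v\<^sub>0\<close>. For even \<open>N\<close> the eigenvalues of the \<open>v\<^sub>i\<close> are distinct and the module
  is \<open>B(N)\<close>. For \<open>N = 2d + 1\<close> the eigenvalues of \<open>v\<^sub>i\<close> and \<open>v\<^sub>N\<^sub>-\<^sub>i\<close> agree, and the folded vectors
  \<open>v\<^sub>i \<plusminus> v\<^sub>N\<^sub>-\<^sub>i\<close> with \<open>i \<le> d\<close> span a module of type \<open>AB(d, n)\<close>.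

  The types are told apart by the eigenvalues of \<open>x\<close> and, for \<open>AB(d, n)\<close>, by the eigenvalue of
  \<open>y \<plusminus> z\<close> on the eigenspace of \<open>x\<close> for the eigenvalue \<open>\<plusminus>1\<close>.\<close>

section \<open>The algebra\<close>

lemma alg_cases: obtains p where "a = abs_alg p"
  using Quotient3_abs_rep[OF Quotient3_alg] by metis

lemma scalar_add: "scalar (a + b) = scalar a + scalar b"
  by (simp add: scalar.abs_eq plus_alg.abs_eq single_add)

lemma scalar_mult: "scalar (a * b) = scalar a * scalar b"
  by (simp add: scalar.abs_eq times_alg.abs_eq mult_single)

lemma scalar_0: "scalar 0 = 0"
  by (simp add: scalar.abs_eq zero_alg.abs_eq)

lemma scalar_1: "scalar 1 = 1"
  by (simp add: scalar.abs_eq one_alg.abs_eq)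

lemma scalar_uminus: "scalar (- a) = - scalar a"
  using scalar_add[of a "- a"] by (simp add: scalar_0 eq_neg_iff_add_eq_0 add.commute)

lemma scalar_diff: "scalar (a - b) = scalar a - scalar b"
  using scalar_add[of a "- b"] by (simp add: scalar_uminus)

lemma scalar_2: "scalar 2 = 2"
  using scalar_add[of 1 1] by (simp add: scalar_1)

text \<open>The empty word is neutral on both sides, so constants commute with every monomial
  already in the free algebra.\<close>

lemma scalar_commute: "scalar c * a = a * scalar c"
proof -
  obtain p where a: "a = abs_alg p" by (rule alg_cases)
  have "Poly_Mapping.single 0 c * p = p * Poly_Mapping.single 0 c"
    by (induction p rule: poly_mapping_induct_monomial)
      (simp_all add: mult_single mult.commute distrib_left distrib_right)
  then show ?thesis
    by (simp add: a scalar.abs_eq times_alg.abs_eq)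
qed

text \<open>A word is a product of generators, a monomial is a scalar times a word, and every
  element is a sum of monomials. This reduces the intertwining property of a linear map to scalars
  and generators.\<close>

lemma alg_induct [case_names scalar gen add mult]:
  fixes P :: "'k::field alg \<Rightarrow> bool"
  assumes "\<And>c. P (scalar c)" "\<And>g. P (gen_alg g)"
    and "\<And>a b. P a \<Longrightarrow> P b \<Longrightarrow> P (a + b)" "\<And>a b. P a \<Longrightarrow> P b \<Longrightarrow> P (a * b)"
  shows "P a"
proof -
  have word: "P (abs_alg (Poly_Mapping.single (Word gs) 1))" for gs
  proof (induction gs)
    case Nil
    show ?case using assms(1)[of 1] by (simp add: scalar.abs_eq zero_word_def)
  next
    case (Cons g gs)
    have "abs_alg (Poly_Mapping.single (Word (g # gs)) 1)
        = gen_alg g * (abs_alg (Poly_Mapping.single (Word gs) 1) :: 'k alg)"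
      by (simp add: gen_alg.abs_eq free_gen_def times_alg.abs_eq mult_single plus_word_def)
    then show ?case using assms(4)[OF assms(2) Cons] by simp
  qed
  have "P (abs_alg p)" for p
  proof (induction p rule: poly_mapping_induct_monomial)
    case (1 w c)
    have "abs_alg (Poly_Mapping.single w c) = scalar c * abs_alg (Poly_Mapping.single w 1)"
      by (simp add: scalar.abs_eq times_alg.abs_eq mult_single)
    then show ?case using assms(1,4) word[of "letters w"] by simp
  next
    case (2 p q)
    then show ?case using assms(3) by (simp flip: plus_alg.abs_eq)
  qed
  then show ?thesis using alg_cases by metis
qed

section \<open>Linear algebra in a module\<close>

text \<open>Gaussian elimination: an equation with a nonzero coefficient eliminates one unknown, and
  an equation without one is void, so the unknowns stay in the majority.\<close>

lemma homogeneous_system_nontrivial: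
  fixes a :: "'i \<Rightarrow> 's \<Rightarrow> 'k::field"
  assumes "finite S" "finite A" "card S < card A"
  shows "\<exists>b. (\<exists>i\<in>A. b i \<noteq> 0) \<and> (\<forall>s\<in>S. (\<Sum>i\<in>A. b i * a i s) = 0)"
  using assms
proof (induction S arbitrary: A a rule: finite_induct)
  case empty
  then obtain i where "i \<in> A" by fastforce
  then show ?case by (intro exI[of _ "\<lambda>_. 1"]) auto
next
  case (insert s S)
  show ?case
  proof (cases "\<forall>i\<in>A. a i s = 0")
    case True
    have "card S < card A" using insert by simp
    then obtain b where "\<exists>i\<in>A. b i \<noteq> 0" "\<forall>s\<in>S. (\<Sum>i\<in>A. b i * a i s) = 0"
      using insert.IH[of A a] insert.prems by blast
    then show ?thesis using True by (intro exI[of _ b]) auto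
  next
    case False
    then obtain j where j: "j \<in> A" "a j s \<noteq> 0" by blast
    \<comment> \<open>Unknown \<open>j\<close> is eliminated by equation \<open>s\<close>, whose new
      coefficients are all zero.\<close>
    define a' where "a' i t = a i t - a i s / a j s * a j t" for i t
    have "card S < card (A - {j})" using insert j by simp
    then obtain b where b: "\<exists>i\<in>A - {j}. b i \<noteq> 0" "\<forall>t\<in>S. (\<Sum>i\<in>A - {j}. b i * a' i t) = 0"
      using insert.IH[of "A - {j}" a'] insert.prems by blast
    \<comment> \<open>The value at \<open>j\<close> is read off from equation
      \<open>s\<close>.\<close>
    define b' where "b' = b(j := - (\<Sum>i\<in>A - {j}. b i * (a i s / a j s)))"
    have sum: "(\<Sum>i\<in>A. b' i * a i t) = (\<Sum>i\<in>A - {j}. b i * a' i t)" for t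
    proof -
      have "(\<Sum>i\<in>A. b' i * a i t) = b' j * a j t + (\<Sum>i\<in>A - {j}. b' i * a i t)"
        using j insert.prems by (intro sum.remove) auto
      also have "(\<Sum>i\<in>A - {j}. b' i * a i t) = (\<Sum>i\<in>A - {j}. b i * a i t)"
        by (intro sum.cong) (auto simp: b'_def)
      finally have "(\<Sum>i\<in>A. b' i * a i t) = b' j * a j t + (\<Sum>i\<in>A - {j}. b i * a i t)" .
      moreover have "b' j * a j t = - (\<Sum>i\<in>A - {j}. b i * (a i s / a j s) * a j t)"
        by (simp add: b'_def sum_distrib_right)
      ultimately show ?thesis
        by (simp add: a'_def sum_subtractf right_diff_distrib mult.assoc)
    qed
    have "a' i s = 0" for i using j by (simp add: a'_def)
    then have "\<forall>t\<in>insert s S. (\<Sum>i\<in>A. b' i * a i t) = 0"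
      using b(2) by (simp add: sum)
    moreover have "\<exists>i\<in>A. b' i \<noteq> 0" using b(1) by (auto simp: b'_def)
    ultimately show ?thesis by blast
  qed
qed

section \<open>Elementary rules for module actions\<close>

context left_module
begin

lemma act_zero_right [simp]: "act a 0 = 0"
  using act_add_right[OF zero_closed zero_closed, of a] by simp

lemma act_zero_left [simp]: "u \<in> V \<Longrightarrow> act 0 u = 0"
  using act_add_left[of u 0 0] by simp

lemma act_uminus_left: "u \<in> V \<Longrightarrow> act (- a) u = - act a u"
  using act_add_left[of u a "- a"] by (simp add: eq_neg_iff_add_eq_0 add.commute)

lemma act_diff_left: "u \<in> V \<Longrightarrow> act (a - b) u = act a u - act b u"
  using act_add_left[of u a "- b"] by (simp add: act_uminus_left)

lemma uminus_closed: "u \<in> V \<Longrightarrow> - u \<in> V"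
  using act_closed[of u "- 1"] by (simp add: act_uminus_left act_one)

lemma diff_closed: "u \<in> V \<Longrightarrow> v \<in> V \<Longrightarrow> u - v \<in> V"
  using add_closed[of u "- v"] by (simp add: uminus_closed)

lemma sum_closed: "(\<And>i. i \<in> A \<Longrightarrow> f i \<in> V) \<Longrightarrow> (\<Sum>i\<in>A. f i) \<in> V"
  by (induction A rule: infinite_finite_induct) (auto simp: zero_closed add_closed)

lemma act_uminus_right: "u \<in> V \<Longrightarrow> act a (- u) = - act a u"
  using act_add_right[of u "- u" a] by (simp add: uminus_closed eq_neg_iff_add_eq_0 add.commute)

lemma act_diff_right: "u \<in> V \<Longrightarrow> v \<in> V \<Longrightarrow> act a (u - v) = act a u - act a v"
  using act_add_right[of u "- v" a] by (simp add: uminus_closed act_uminus_right)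

lemma act_sum_right:
  "(\<And>i. i \<in> A \<Longrightarrow> f i \<in> V) \<Longrightarrow> act a (\<Sum>i\<in>A. f i) = (\<Sum>i\<in>A. act a (f i))"
  by (induction A rule: infinite_finite_induct) (auto simp: act_add_right sum_closed)

lemma act_sum_left: "u \<in> V \<Longrightarrow> act (\<Sum>i\<in>A. f i) u = (\<Sum>i\<in>A. act (f i) u)"
  by (induction A rule: infinite_finite_induct) (auto simp: act_add_left)

end

locale alg_module = left_module V act
  for V :: "'v::ab_group_add set" and act :: "'k::field alg \<Rightarrow> 'v \<Rightarrow> 'v"
begin

definition scale :: "'k \<Rightarrow> 'v \<Rightarrow> 'v" where "scale c u = act (scalar c) u"

lemma scale_closed: "u \<in> V \<Longrightarrow> scale c u \<in> V"
  by (simp add: scale_def act_closed)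

lemma scale_simps:
  "u \<in> V \<Longrightarrow> scale 0 u = 0" "u \<in> V \<Longrightarrow> scale 1 u = u" "scale c 0 = 0"
  "u \<in> V \<Longrightarrow> scale a (scale b u) = scale (a * b) u"
  "u \<in> V \<Longrightarrow> act (scalar c) u = scale c u"
  by (simp_all add: scale_def scalar_0 scalar_1 scalar_mult act_mult act_one)

lemma scale_add_left: "u \<in> V \<Longrightarrow> scale (a + b) u = scale a u + scale b u"
  by (simp add: scale_def scalar_add act_add_left)

lemma scale_uminus_left: "u \<in> V \<Longrightarrow> scale (- a) u = - scale a u"
  by (simp add: scale_def scalar_uminus act_uminus_left)

lemma scale_diff_left: "u \<in> V \<Longrightarrow> scale (a - b) u = scale a u - scale b u"
  using scale_add_left[of u a "- b"] by (simp add: scale_uminus_left)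

lemma scale_add_right: "u \<in> V \<Longrightarrow> v \<in> V \<Longrightarrow> scale a (u + v) = scale a u + scale a v"
  by (simp add: scale_def act_add_right)

lemma scale_uminus_right: "u \<in> V \<Longrightarrow> scale a (- u) = - scale a u"
  by (simp add: scale_def act_uminus_right)

lemma scale_diff_right: "u \<in> V \<Longrightarrow> v \<in> V \<Longrightarrow> scale a (u - v) = scale a u - scale a v"
  by (simp add: scale_def act_diff_right)

lemma act_scale: "u \<in> V \<Longrightarrow> act a (scale c u) = scale c (act a u)"
  unfolding scale_def by (metis act_mult scalar_commute)

lemma act_scalar_mult: "u \<in> V \<Longrightarrow> act (scalar c * a) u = scale c (act a u)"
  by (simp add: scale_def act_mult)

lemma scale_sum_right:
  "(\<And>i. i \<in> A \<Longrightarrow> f i \<in> V) \<Longrightarrow> scale c (\<Sum>i\<in>A. f i) = (\<Sum>i\<in>A. scale c (f i))"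
  unfolding scale_def by (rule act_sum_right)

lemma scale_sum_left: "u \<in> V \<Longrightarrow> scale (\<Sum>i\<in>A. f i) u = (\<Sum>i\<in>A. scale (f i) u)"
  by (induction A rule: infinite_finite_induct) (auto simp: scale_simps scale_add_left)

lemma scale_eq_0_iff: "u \<in> V \<Longrightarrow> scale c u = 0 \<longleftrightarrow> c = 0 \<or> u = 0"
proof
  assume u: "u \<in> V" and eq: "scale c u = 0"
  have "u = scale (inverse c) (scale c u)" if "c \<noteq> 0"
    using u that by (simp add: scale_simps)
  then show "c = 0 \<or> u = 0" using eq by (auto simp: scale_simps)
qed (auto simp: scale_simps)

text \<open>Applying \<open>a - scalar (l j)\<close> to the relation removes the term at
  \<open>j\<close> and multiplies every other term by the nonzero factor \<open>l i - l j\<close>,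
  which leaves a shorter relation of the same kind.\<close>

lemma eigenvectors_independent:
  assumes "finite A" "\<And>i. i \<in> A \<Longrightarrow> u i \<in> V"
    and "\<And>i. i \<in> A \<Longrightarrow> act a (u i) = scale (l i) (u i)"
    and "inj_on l A" "(\<Sum>i\<in>A. u i) = 0" "i \<in> A"
  shows "u i = 0"
  using assms
proof (induction A arbitrary: u i rule: finite_induct)
  case (insert j A)
  have eq: "u j + (\<Sum>i\<in>A. u i) = 0" using insert by simp
  have uV: "i \<in> A \<Longrightarrow> u i \<in> V" "u j \<in> V" for i using insert.prems by auto
  have "0 = act a (u j + (\<Sum>i\<in>A. u i)) - scale (l j) (u j + (\<Sum>i\<in>A. u i))"
    using eq by (simp add: scale_simps)
  also have "\<dots> = (\<Sum>i\<in>A. scale (l i - l j) (u i))"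
    using uV insert.prems(2)
    by (simp add: act_add_right scale_add_right act_sum_right scale_sum_right sum_closed
        scale_diff_left sum_subtractf)
  finally have sum0: "(\<Sum>i\<in>A. scale (l i - l j) (u i)) = 0" by simp
  have scaled0: "scale (l i - l j) (u i) = 0" if "i \<in> A" for i
  proof (rule insert.IH[of "\<lambda>i. scale (l i - l j) (u i)", OF _ _ _ sum0 that])
    show "scale (l i - l j) (u i) \<in> V" if "i \<in> A" for i
      using that uV by (simp add: scale_closed)
    show "act a (scale (l i - l j) (u i)) = scale (l i) (scale (l i - l j) (u i))" if "i \<in> A" for i
      using that uV insert.prems(2) by (simp add: act_scale scale_simps mult.commute)
    show "inj_on l A" using insert.prems by simp
  qed
  then have u0: "u i = 0" if "i \<in> A" for i
  proof -
    have "l i \<noteq> l j" using that insert.hyps inj_onD[OF insert.prems(3), of i j] by auto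
    then show ?thesis using that uV scaled0[OF that] by (simp add: scale_eq_0_iff)
  qed
  then have "u j = 0" using eq by simp
  then show ?case using u0 insert.prems by auto
qed simp

end

locale finite_dimensional_alg_module = alg_module V act
  for V :: "'v::ab_group_add set" and act :: "'k::field alg \<Rightarrow> 'v \<Rightarrow> 'v" +
  assumes finite_dimensional: "finite_dimensional_module V act"
begin

lemma infinite_family_dependent:
  fixes w :: "nat \<Rightarrow> 'v"
  assumes "\<And>i. w i \<in> V"
  obtains n b i where "(\<Sum>i\<le>n. scale (b i) (w i)) = 0" "i \<le> n" "b i \<noteq> 0"
proof -
  obtain S where S: "finite S" "S \<subseteq> V"
    "\<And>v. v \<in> V \<Longrightarrow> \<exists>c. v = (\<Sum>s\<in>S. act (scalar (c s)) s)"
    using finite_dimensional unfolding finite_dimensional_module_def by blast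
  have "\<forall>i. \<exists>c. w i = (\<Sum>s\<in>S. act (scalar (c s)) s)" using S(3) assms by blast
  then obtain c where c: "\<And>i. w i = (\<Sum>s\<in>S. act (scalar (c i s)) s)" by metis
  have sV: "s \<in> S \<Longrightarrow> s \<in> V" for s using S(2) by blast
  \<comment> \<open>The index set \<open>{..card S}\<close> has one element more than the spanning
    set. Relations are indexed by numbers, so repeated vectors cause no trouble.\<close>
  have "card S < card {..card S}" by simp
  then obtain b where b: "\<exists>i\<in>{..card S}. b i \<noteq> 0"
    "\<forall>s\<in>S. (\<Sum>i\<le>card S. b i * c i s) = 0"
    using homogeneous_system_nontrivial[OF S(1), of "{..card S}" c] by blast
  have "(\<Sum>i\<le>card S. scale (b i) (w i)) = (\<Sum>i\<le>card S. \<Sum>s\<in>S. scale (b i * c i s) s)"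
    unfolding c by (intro sum.cong refl) (simp add: sV scale_closed scale_sum_right scale_simps)
  also have "\<dots> = (\<Sum>s\<in>S. scale (\<Sum>i\<le>card S. b i * c i s) s)"
    by (subst sum.swap) (simp add: sV scale_sum_left)
  also have "\<dots> = 0" using b(2) sV by (simp add: scale_simps)
  finally show thesis using b(1) that by auto
qed

text \<open>A nontrivial relation among the \<open>w i\<close> falls apart into its terms because
  the eigenvalues are distinct. This is what makes every chain of eigenvectors stop.\<close>

lemma eigenvectors_vanish:
  fixes w :: "nat \<Rightarrow> 'v"
  assumes "\<And>i. w i \<in> V" "\<And>i. act a (w i) = scale (l i) (w i)" "inj l"
  obtains i where "w i = 0"
proof -
  obtain n b i where b: "(\<Sum>i\<le>n. scale (b i) (w i)) = 0" "i \<le> n" "b i \<noteq> 0"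
    using infinite_family_dependent[of w, OF assms(1)] .
  have "scale (b i) (w i) = 0"
  proof (rule eigenvectors_independent[OF _ _ _ _ b(1)])
    show "act a (scale (b j) (w j)) = scale (l j) (scale (b j) (w j))" for j
      by (simp add: act_scale assms(1,2) scale_simps(4) mult.commute)
    show "inj_on l {..n}" using assms(3) by (rule inj_on_subset) simp
  qed (simp_all add: b(2) scale_closed assms(1))
  then have "w i = 0" using b(3) by (simp add: scale_eq_0_iff[OF assms(1)])
  then show thesis by (rule that)
qed

end

section \<open>Polynomials in an algebra element and existence of eigenvectors\<close>

text \<open>The library's \<open>poly\<close> needs a commutative ring.\<close>

definition poly_eval :: "'k::field poly \<Rightarrow> 'k alg \<Rightarrow> 'k alg" where
  "poly_eval p a = (\<Sum>i\<le>degree p. scalar (coeff p i) * a ^ i)"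

lemma poly_eval_superset:
  assumes "degree p \<le> n"
  shows "poly_eval p a = (\<Sum>i\<le>n. scalar (coeff p i) * a ^ i)"
  unfolding poly_eval_def using assms
  by (intro sum.mono_neutral_left) (auto simp: coeff_eq_0 scalar_0)

text \<open>Splitting off a linear factor is the product rule required for finding eigenvectors; it
  rests on the scalars being central.\<close>

lemma poly_eval_linear_mult: "poly_eval ([:- r, 1:] * q) a = (a - scalar r) * poly_eval q a"
proof -
  let ?n = "degree q"
  have deg: "degree ([:- r, 1:] * q) \<le> Suc ?n"
    by (rule order_trans[OF degree_mult_le]) simp
  have power: "scalar c * (a * a ^ i) = a * (scalar c * a ^ i)" for c i
    by (metis mult.assoc scalar_commute)
  have co: "coeff ([:- r, 1:] * q) i = coeff (pCons 0 q) i - r * coeff q i" for i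
    by (simp add: mult_pCons_left)
  have "poly_eval ([:- r, 1:] * q) a = (\<Sum>i\<le>Suc ?n. scalar (coeff (pCons 0 q) i) * a ^ i)
      - (\<Sum>i\<le>Suc ?n. scalar r * (scalar (coeff q i) * a ^ i))"
    unfolding poly_eval_superset[OF deg] co sum_subtractf[symmetric]
    by (intro sum.cong refl) (simp add: scalar_diff scalar_mult left_diff_distrib mult.assoc)
  also have "(\<Sum>i\<le>Suc ?n. scalar (coeff (pCons 0 q) i) * a ^ i) = a * poly_eval q a"
    unfolding sum.atMost_Suc_shift poly_eval_def
    by (simp add: scalar_0 sum_distrib_left power)
  also have "(\<Sum>i\<le>Suc ?n. scalar r * (scalar (coeff q i) * a ^ i)) = scalar r * poly_eval q a"
    by (simp add: coeff_eq_0 scalar_0 poly_eval_def sum_distrib_left)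
  finally show ?thesis by (simp add: left_diff_distrib)
qed

text \<open>The vectors \<open>act (a ^ i) v\<close> are dependent, so some nonzero polynomial in
  \<open>a\<close> kills \<open>v\<close>. Take one of least degree and a root \<open>r\<close>: the
  cofactor of the linear factor does not kill \<open>v\<close>, and it sends \<open>v\<close> to an
  eigenvector for \<open>r\<close>. Algebraic closedness enters as the hypothesis on roots.\<close>

lemma (in finite_dimensional_alg_module) eigenvector_exists:
  fixes a :: "'k alg"
  assumes "\<And>p :: 'k poly. 0 < degree p \<Longrightarrow> \<exists>r. poly p r = 0" "v \<in> V" "v \<noteq> 0"
  obtains u c where "u \<in> V" "u \<noteq> 0" "act a u = scale c u"
proof -
  let ?Q = "\<lambda>p. p \<noteq> 0 \<and> act (poly_eval p a) v = 0"
  obtain n b i where b: "(\<Sum>i\<le>n. scale (b i) (act (a ^ i) v)) = 0" "i \<le> n" "b i \<noteq> 0"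
    using infinite_family_dependent[of "\<lambda>i. act (a ^ i) v", OF act_closed[OF assms(2)]] .
  define p0 where "p0 = (\<Sum>i\<le>n. monom (b i) i)"
  have co: "coeff p0 i = (if i \<le> n then b i else 0)" for i
    by (simp add: p0_def coeff_sum)
  have "degree p0 \<le> n" by (rule degree_le) (simp add: co)
  then have "act (poly_eval p0 a) v = (\<Sum>i\<le>n. scale (b i) (act (a ^ i) v))"
    using assms(2) by (simp add: poly_eval_superset co act_sum_left act_scalar_mult)
  moreover have "p0 \<noteq> 0" using b co[of i] by auto
  ultimately have "?Q p0" using b by simp
  then obtain p where p: "?Q p" "\<And>q. ?Q q \<Longrightarrow> degree p \<le> degree q"
    using ex_has_least_nat[of ?Q p0 degree] by metis
  have "degree p \<noteq> 0"
  proof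
    assume "degree p = 0"
    then obtain c where c: "p = [:c:]" by (rule degree_eq_zeroE)
    with p(1) assms(2,3) show False
      by (simp add: poly_eval_def scale_simps(5) scale_eq_0_iff)
  qed
  then obtain r where "poly p r = 0" using assms(1) by blast
  then obtain q where q: "p = [:- r, 1:] * q" by (auto simp: poly_eq_0_iff_dvd)
  have q0: "q \<noteq> 0" using q p(1) by auto
  have "degree q < degree p" unfolding q using q0 by (subst degree_mult_eq) auto
  then have "act (poly_eval q a) v \<noteq> 0" using p(2)[of q] q0 by auto
  moreover have "act a (act (poly_eval q a) v) = scale r (act (poly_eval q a) v)"
    using p(1) assms(2) unfolding q poly_eval_linear_mult
    by (simp add: act_mult act_diff_left act_closed scale_simps)
  ultimately show thesis by (rule that[OF act_closed[OF assms(2)]])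
qed

section \<open>Ladders of eigenvectors\<close>

text \<open>The triple is abstract because the ladder arguments are applied both to the generators
  and to sign-changed copies of them.\<close>

locale spin_triple =
  fixes X Y Z :: "'k::field alg"
  assumes XY: "X * Y + Y * X = 2 * Z" and YZ: "Y * Z + Z * Y = 2 * X" and ZX: "Z * X + X * Z = 2 * Y"
begin

text \<open>The element \<open>D\<^sub>i\<close> of the outline. In a ladder the same
  \<open>step i\<close> raises index \<open>i\<close> to \<open>i + 1\<close> and lowers
  \<open>i + 1\<close> to \<open>i\<close>; \<open>step 1\<close> is y - z.\<close>

definition step :: "nat \<Rightarrow> 'k alg" where "step i = (if even i then Y + Z else Y - Z)"

lemma step_Suc_Suc [simp]: "step (Suc (Suc i)) = step i"
  by (simp add: step_def)

lemma step_cong: "(even i \<longleftrightarrow> even j) \<Longrightarrow> step i = step j"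
  by (simp add: step_def)

text \<open>With e = (-1)^i, moving X to the right past Y + eZ produces 2Z + 2eY = 2e(Y + eZ). The
  squares of Y + eZ and Y - eZ differ by 2e(YZ + ZY) = 4eX.\<close>

lemma X_step: "X * step i = scalar (2 * (-1) ^ i) * step i - step i * X"
  and step_square: "step i * step i = step (Suc i) * step (Suc i) + scalar (4 * (-1) ^ i) * X"
  and twice_Y: "scalar 2 * Y = step i + step (Suc i)"
  and twice_Z: "scalar 2 * Z = scalar ((-1) ^ i) * (step i - step (Suc i))"
proof -
  have XY': "X * Y = 2 * Z - Y * X" and ZX': "X * Z = 2 * Y - Z * X" and YZ': "Z * Y = 2 * X - Y * Z"
    using XY ZX YZ by (simp_all add: algebra_simps)
  have four: "2 * X + 2 * X = 4 * X"
    by (simp flip: distrib_right)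
  have scalar_4: "scalar 4 = (4 :: 'k alg)"
    using scalar_add[of 2 "2 :: 'k"] by (simp add: scalar_2)
  show "X * step i = scalar (2 * (-1) ^ i) * step i - step i * X"
    by (simp add: step_def algebra_simps XY' ZX' scalar_uminus scalar_2)
  show "step i * step i = step (Suc i) * step (Suc i) + scalar (4 * (-1) ^ i) * X"
    by (simp add: step_def algebra_simps YZ' scalar_uminus scalar_4 four)
  show "scalar 2 * Y = step i + step (Suc i)"
    by (simp add: step_def scalar_2 mult_2)
  show "scalar 2 * Z = scalar ((-1) ^ i) * (step i - step (Suc i))"
    by (simp add: step_def scalar_2 mult_2 scalar_1 scalar_uminus)
qed

lemma sign_change: "spin_triple X (- Y) (- Z)"
  using XY YZ ZX by (unfold_locales; simp add: algebra_simps eq_neg_iff_add_eq_0 neg_eq_iff_add_eq_0)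

end

lemma spin_triple_gen: "spin_triple (gen_alg Gx) (gen_alg Gy) (gen_alg Gz)"
  by unfold_locales (rule gen_alg_relations)+

locale spin_module = alg_module V act + spin_triple X Y Z
  for V :: "'v::ab_group_add set" and act :: "'k::field_char_0 alg \<Rightarrow> 'v \<Rightarrow> 'v" and X Y Z :: "'k alg"
begin

lemma act_X_step:
  assumes "u \<in> V" "act X u = scale ((-1) ^ i * c) u"
  shows "act X (act (step i) u) = scale ((-1) ^ Suc i * (c - 2)) (act (step i) u)"
proof -
  have "act X (act (step i) u) = act (X * step i) u"
    using assms(1) by (simp add: act_mult)
  also have "\<dots> = scale (2 * (-1) ^ i) (act (step i) u) - scale ((-1) ^ i * c) (act (step i) u)"
    unfolding X_step using assms by (simp add: act_diff_left act_mult act_scale act_closed scale_simps(5))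
  also have "\<dots> = scale (2 * (-1) ^ i - (-1) ^ i * c) (act (step i) u)"
    using assms(1) by (simp add: scale_diff_left act_closed)
  also have "2 * (-1) ^ i - (-1) ^ i * c = (-1) ^ Suc i * (c - 2)"
    by (simp add: algebra_simps)
  finally show ?thesis .
qed

end

text \<open>The relations of \<open>B(d)\<close> with \<open>d\<close> replaced by a parameter \<open>c\<close>, rewritten in terms of
  \<open>y \<plusminus> z\<close>. Both \<open>B(d)\<close> (with \<open>c = d\<close>) and \<open>AB(d, 0)\<close> (up to signs, with \<open>c = 2 d + 1\<close>) are of
  this form; they differ in the value of \<open>u (d + 1)\<close>.\<close>

locale ladder = spin_module V act X Y Z
  for V :: "'v::ab_group_add set" and act :: "'k::field_char_0 alg \<Rightarrow> 'v \<Rightarrow> 'v" and X Y Z :: "'k alg" +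
  fixes d :: nat and c :: 'k and u :: "nat \<Rightarrow> 'v"
  assumes u_closed: "i \<le> Suc d \<Longrightarrow> u i \<in> V"
    and act_X: "i \<le> d \<Longrightarrow> act X (u i) = scale ((-1) ^ i * (c - 2 * of_nat i)) (u i)"
    and step_up: "i \<le> d \<Longrightarrow> act (step i) (u i) = scale (2 * of_nat (Suc i)) (u (Suc i))"
    and step_down: "i < d \<Longrightarrow> act (step i) (u (Suc i)) = scale (2 * (c - of_nat i)) (u i)"
    and step_bottom: "act (step 1) (u 0) = 0"
begin

text \<open>The lowering coefficient \<open>2 * (c - of_nat i)\<close> does not vanish, so a zero at
  \<open>i + 1\<close> would propagate down to \<open>u 0\<close>.\<close>

lemma nonzero:
  assumes "u 0 \<noteq> 0" "\<And>i. i < d \<Longrightarrow> c \<noteq> of_nat i"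
  shows "i \<le> d \<Longrightarrow> u i \<noteq> 0"
proof (induction i)
  case (Suc i)
  show ?case
  proof
    assume "u (Suc i) = 0"
    then have "scale (2 * (c - of_nat i)) (u i) = 0" using step_down[of i] Suc.prems by simp
    then have "2 * (c - of_nat i) = 0 \<or> u i = 0" using scale_eq_0_iff u_closed Suc.prems by simp
    then show False using assms(2)[of i] Suc by simp
  qed
qed (use assms in simp)

text \<open>On \<open>u i\<close>, \<open>step i\<close> raises and \<open>step (Suc i)\<close>
  lowers; Y and Z are half their sum and, up to sign, half their difference. The value 0 at
  \<open>i = 0\<close> stands for the missing vector of index -1.\<close>

lemma act_YZ:
  assumes "i \<le> d"
  shows "act Y (u i) = scale (c - of_nat i + 1) (if i = 0 then 0 else u (i - 1))
      + scale (of_nat i + 1) (u (Suc i))" (is ?Y)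
    and "act Z (u i) = scale (- ((-1) ^ i) * (c - of_nat i + 1)) (if i = 0 then 0 else u (i - 1))
      + scale ((-1) ^ i * (of_nat i + 1)) (u (Suc i))" (is ?Z)
proof -
  define u' where "u' = (if i = 0 then 0 else u (i - 1))"
  define l where "l = scale (c - of_nat i + 1) u'"
  have u': "u' \<in> V" using assms u_closed by (auto simp: u'_def zero_closed)
  have ui: "u i \<in> V" "u (Suc i) \<in> V" using assms u_closed by auto
  have l: "l \<in> V" using u' by (simp add: l_def scale_closed)
  have half: "scale (1 / 2) (scale 2 v) = v" if "v \<in> V" for v
    using that by (simp add: scale_simps)
  have down: "act (step (Suc i)) (u i) = scale 2 l"
  proof (cases i)
    case 0
    then show ?thesis using step_bottom by (simp add: l_def u'_def scale_simps)
  next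
    case (Suc j)
    then show ?thesis using step_down[of j] assms u_closed[of j]
      by (simp add: l_def u'_def scale_simps)
  qed
  have up: "act (step i) (u i) = scale 2 (scale (of_nat (Suc i)) (u (Suc i)))"
    using step_up[OF assms(1)] ui by (simp add: scale_simps(4))
  have "scale 2 (act Y (u i)) = scale 2 (l + scale (of_nat (Suc i)) (u (Suc i)))"
    using ui l by (simp add: act_scalar_mult[symmetric] twice_Y[of i] act_add_left up down
        scale_add_right scale_closed add.commute)
  then have "act Y (u i) = l + scale (of_nat (Suc i)) (u (Suc i))"
    using half ui l act_closed scale_closed add_closed by metis
  then show ?Y by (simp add: l_def u'_def add.commute)
  have "scale 2 (act Z (u i))
      = scale 2 (scale ((-1) ^ i) (scale (of_nat (Suc i)) (u (Suc i)) - l))"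
    using ui l by (simp add: act_scalar_mult[symmetric] twice_Z[of i] del: of_nat_Suc)
      (simp add: act_scalar_mult act_diff_left up down scale_diff_right scale_closed diff_closed
        scale_simps(4) mult_ac del: of_nat_Suc)
  then have "act Z (u i) = scale ((-1) ^ i) (scale (of_nat (Suc i)) (u (Suc i)) - l)"
    using half ui l act_closed scale_closed diff_closed by metis
  also have "\<dots> = scale (- ((-1) ^ i) * (c - of_nat i + 1)) u'
      + scale ((-1) ^ i * (of_nat i + 1)) (u (Suc i))"
    using ui u' by (simp add: l_def scale_diff_right scale_simps(4) scale_closed scale_uminus_left
        add.commute)
  finally show ?Z by (simp only: u'_def)
qed

end

context spin_module
begin

text \<open>One infinite sequence serves for every length \<open>d\<close>, since a ladder imposes
  no condition at its top. The cut is made later, where the sequence vanishes.\<close>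

lemma ladder_from_bottom:
  assumes "v \<in> V" "act X v = scale c v" "act (step 1) v = 0"
  obtains u where "u 0 = v" "\<And>d. ladder V act X Y Z d c u"
proof -
  \<comment> \<open>The normalisation is forced by the coefficient in \<open>step_up\<close>;
    characteristic zero permits the division.\<close>
  define u where "u = rec_nat v (\<lambda>i w. scale (1 / (2 * of_nat (Suc i))) (act (step i) w))"
  have u0: "u 0 = v" by (simp add: u_def)
  have uS: "u (Suc i) = scale (1 / (2 * of_nat (Suc i))) (act (step i) (u i))" for i
    by (simp add: u_def)
  have uV: "u i \<in> V" for i
    by (induction i) (simp_all add: u0 uS assms(1) scale_closed act_closed)
  have X: "act X (u i) = scale ((-1) ^ i * (c - 2 * of_nat i)) (u i)" for i
  proof (induction i)
    case (Suc i)
    have "act X (u (Suc i)) = scale (1 / (2 * of_nat (Suc i))) (act X (act (step i) (u i)))"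
      unfolding uS using uV by (simp add: act_scale act_closed)
    also have "act X (act (step i) (u i))
        = scale ((-1) ^ Suc i * (c - 2 * of_nat i - 2)) (act (step i) (u i))"
      using uV Suc by (rule act_X_step)
    also have "(-1) ^ Suc i * (c - 2 * of_nat i - 2) = (-1) ^ Suc i * (c - 2 * of_nat (Suc i))"
      by (simp add: algebra_simps)
    finally show ?case
      unfolding uS using uV by (simp only: scale_simps(4) act_closed mult.commute)
  qed (simp add: u0 assms(2))
  have up: "act (step i) (u i) = scale (2 * of_nat (Suc i)) (u (Suc i))" for i
  proof -
    have "2 * of_nat (Suc i) * (1 / (2 * of_nat (Suc i))) = (1 :: 'k)"
      by (simp del: of_nat_Suc)
    then show ?thesis unfolding uS using uV by (simp only: scale_simps(2,4) act_closed)
  qed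
  have down: "act (step i) (u (Suc i)) = scale (2 * (c - of_nat i)) (u i)" for i
  proof (induction i)
    case 0
    have "act (step 0) (u 1) = scale (1 / 2) (act (step 0 * step 0) v)"
      using assms(1) by (simp add: uS u0 act_scale act_closed act_mult)
    also have "act (step 0 * step 0) v = scale (4 * c) v"
      unfolding step_square[of 0] using assms
      by (simp add: act_add_left act_mult scale_closed scale_simps(4,5))
    finally show ?case using assms(1) by (simp add: u0 scale_simps(4))
  next
    case (Suc i)
    let ?j = "Suc i"
    \<comment> \<open>By \<open>step_square\<close> the square of \<open>step ?j\<close> is traded
      for that of \<open>step i\<close>, which lowers \<open>u ?j\<close> to \<open>u i\<close> and
      raises it back, plus a multiple of X. The identity behind the sum is j(c - j + 1) + (c - 2j) =
      (j + 1)(c - j).\<close>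
    have "act (step ?j * step ?j) (u ?j)
        = act (step i) (act (step i) (u ?j)) + scale (4 * (-1) ^ ?j) (act X (u ?j))"
      unfolding step_square[of ?j] using uV
      by (simp add: act_add_left act_mult act_closed scale_simps(5) del: power_Suc)
    also have "\<dots> = scale (2 * (c - of_nat i)) (scale (2 * of_nat ?j) (u ?j))
        + scale (4 * (-1) ^ ?j) (scale ((-1) ^ ?j * (c - 2 * of_nat ?j)) (u ?j))"
      unfolding Suc X using uV by (simp only: act_scale up)
    also have "\<dots> = scale (2 * (c - of_nat i) * (2 * of_nat ?j)
        + 4 * (-1) ^ ?j * ((-1) ^ ?j * (c - 2 * of_nat ?j))) (u ?j)"
      using uV by (simp only: scale_simps(4) scale_add_left)
    also have "2 * (c - of_nat i) * (2 * of_nat ?j)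
        + 4 * (-1) ^ ?j * ((-1) ^ ?j * (c - 2 * of_nat ?j))
        = 2 * of_nat (Suc ?j) * (2 * (c - of_nat ?j))"
      by (simp add: algebra_simps minus_one_power_square)
    finally have sq: "act (step ?j * step ?j) (u ?j)
        = scale (2 * of_nat (Suc ?j) * (2 * (c - of_nat ?j))) (u ?j)" .
    have "act (step ?j) (u (Suc ?j))
        = scale (1 / (2 * of_nat (Suc ?j))) (act (step ?j * step ?j) (u ?j))"
      unfolding uS[of ?j] using uV by (simp only: act_scale act_closed act_mult)
    also have "\<dots> = scale (1 / (2 * of_nat (Suc ?j)) * (2 * of_nat (Suc ?j) * (2 * (c - of_nat ?j)))) (u ?j)"
      unfolding sq using uV by (simp only: scale_simps(4))
    also have "1 / (2 * of_nat (Suc ?j)) * (2 * of_nat (Suc ?j) * (2 * (c - of_nat ?j)))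
        = 2 * (c - of_nat ?j)"
      by (simp del: of_nat_Suc)
    finally show ?case .
  qed
  show thesis
  proof (rule that)
    show "ladder V act X Y Z d c u" for d
      by unfold_locales (use uV X up down assms(3) u0 in simp_all)
  qed (rule u0)
qed

end

text \<open>For odd \<open>N\<close> the reversal \<open>v\<^sub>i \<mapsto> v\<^sub>N\<^sub>-\<^sub>i\<close> preserves the relations of a ladder, since \<open>i\<close> and \<open>N - i\<close>
  have opposite parity.\<close>

lemma (in spin_module) ladder_fold:
  assumes "ladder V act X Y Z (2 * d + 1) (of_nat (2 * d + 1)) v"
    and "v (2 * d + 2) = 0"
  shows "ladder V act X Y Z d (of_nat (2 * d + 1)) (\<lambda>i. v i + v (2 * d + 1 - i))"
proof -
  interpret v: ladder V act X Y Z "2 * d + 1" "of_nat (2 * d + 1)" v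
    by (rule assms(1))
  let ?N = "2 * d + 1"
  have N: "of_nat (?N - i) = (of_nat ?N - of_nat i :: 'k)" if "i \<le> ?N" for i
    using that by (rule of_nat_diff)
  have par: "even (?N - i) \<longleftrightarrow> odd i" if "i \<le> ?N" for i using that by auto
  have sgn: "(-1) ^ (?N - i) = (- ((-1) ^ i) :: 'k)" if "i \<le> ?N" for i
    using par[OF that] by (cases "even i") auto
  show ?thesis
  proof
    fix i
    show "v i + v (?N - i) \<in> V" if "i \<le> Suc d"
      using that by (intro add_closed v.u_closed) auto
    show "act X (v i + v (?N - i)) = scale ((-1) ^ i * (of_nat ?N - 2 * of_nat i)) (v i + v (?N - i))"
      if "i \<le> d"
    proof -
      have "(-1) ^ (?N - i) * (of_nat ?N - 2 * of_nat (?N - i))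
          = ((-1) ^ i * (of_nat ?N - 2 * of_nat i) :: 'k)"
        using that by (simp only: N sgn) (simp add: algebra_simps)
      then show ?thesis using that v.act_X[of i] v.act_X[of "?N - i"] v.u_closed[of i] v.u_closed[of "?N - i"]
        by (simp add: act_add_right scale_add_right)
    qed
    show "act (step i) (v i + v (?N - i)) = scale (2 * of_nat (Suc i)) (v (Suc i) + v (?N - Suc i))"
      if "i \<le> d"
    proof -
      have "step i = step (?N - Suc i)" using par[of "Suc i"] that by (intro step_cong) auto
      moreover have "?N - i = Suc (?N - Suc i)" using that by simp
      \<comment> \<open>The lowering coefficient at the reflected index is the raising coefficient
        at \<open>i\<close>.\<close>
      moreover have "2 * (of_nat ?N - of_nat (?N - Suc i)) = (2 * of_nat (Suc i) :: 'k)"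
        using that by (subst N) auto
      ultimately have "act (step i) (v (?N - i)) = scale (2 * of_nat (Suc i)) (v (?N - Suc i))"
        using v.step_down[of "?N - Suc i"] that by simp
      then show ?thesis
        using that v.step_up[of i] v.u_closed[of i] v.u_closed[of "Suc i"] v.u_closed[of "?N - i"]
          v.u_closed[of "?N - Suc i"]
        by (simp add: act_add_right scale_add_right)
    qed
    show "act (step i) (v (Suc i) + v (?N - Suc i)) = scale (2 * (of_nat ?N - of_nat i)) (v i + v (?N - i))"
      if "i < d"
    proof -
      have "step i = step (?N - Suc i)" using par[of "Suc i"] that by (intro step_cong) auto
      moreover have "?N - i = Suc (?N - Suc i)" using that by simp
      ultimately have "act (step i) (v (?N - Suc i)) = scale (2 * of_nat (?N - i)) (v (?N - i))"
        using v.step_up[of "?N - Suc i"] that by simp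
      moreover have "of_nat (?N - i) = (of_nat ?N - of_nat i :: 'k)" using that by (intro N) simp
      ultimately show ?thesis
        using that v.step_down[of i] v.u_closed[of i] v.u_closed[of "Suc i"] v.u_closed[of "?N - i"]
          v.u_closed[of "?N - Suc i"]
        by (simp add: act_add_right scale_add_right)
    qed
    show "act (step 1) (v 0 + v (?N - 0)) = 0"
    proof -
      \<comment> \<open>As \<open>?N\<close> is odd, \<open>step 1\<close> raises the top vector,
        and the next one is zero by assumption.\<close>
      have "act (step 1) (v ?N) = scale (2 * of_nat (Suc ?N)) (v (Suc ?N))"
        using v.step_up[of ?N] step_cong[of 1 ?N] by simp
      then show ?thesis
        using assms(2) v.step_bottom v.u_closed[of 0] v.u_closed[of ?N]
        by (simp add: act_add_right scale_simps(3))
    qed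
  qed
qed

section \<open>Isomorphisms with the listed modules\<close>

lemma module_isomorphic_sym:
  assumes "left_module V act" "module_isomorphic V act W act'"
  shows "module_isomorphic W act' V act"
proof -
  interpret left_module V act by fact
  obtain f where f: "bij_betw f V W" "\<And>u v. u \<in> V \<Longrightarrow> v \<in> V \<Longrightarrow> f (u + v) = f u + f v"
    "\<And>a u. u \<in> V \<Longrightarrow> f (act a u) = act' a (f u)"
    using assms(2) unfolding module_isomorphic_def by blast
  let ?g = "inv_into V f"
  have g: "w \<in> W \<Longrightarrow> ?g w \<in> V" "w \<in> W \<Longrightarrow> f (?g w) = w" "v \<in> V \<Longrightarrow> ?g (f v) = v" for v w
    using f(1) by (auto simp: bij_betw_def intro: inv_into_into f_inv_into_f)
  have "?g (u + v) = ?g u + ?g v" if "u \<in> W" "v \<in> W" for u v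
    using g(3)[of "?g u + ?g v"] f(2)[of "?g u" "?g v"] g(1,2) that add_closed by simp
  moreover have "?g (act' a u) = act a (?g u)" if "u \<in> W" for a u
    using g(3)[of "act a (?g u)"] f(3)[of "?g u" a] g(1,2) that act_closed by simp
  ultimately show ?thesis
    using bij_betw_inv_into[OF f(1)] unfolding module_isomorphic_def by blast
qed

lemma module_isomorphic_trans:
  assumes "module_isomorphic U act V act'" "module_isomorphic V act' W act''"
  shows "module_isomorphic U act W act''"
proof -
  obtain f where f: "bij_betw f U V" "\<And>u v. u \<in> U \<Longrightarrow> v \<in> U \<Longrightarrow> f (u + v) = f u + f v"
    "\<And>a u. u \<in> U \<Longrightarrow> f (act a u) = act' a (f u)"
    using assms(1) unfolding module_isomorphic_def by blast
  obtain g where g: "bij_betw g V W" "\<And>u v. u \<in> V \<Longrightarrow> v \<in> V \<Longrightarrow> g (u + v) = g u + g v"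
    "\<And>a u. u \<in> V \<Longrightarrow> g (act' a u) = act'' a (g u)"
    using assms(2) unfolding module_isomorphic_def by blast
  have "f u \<in> V" if "u \<in> U" for u using that f(1) by (auto simp: bij_betw_def)
  then show ?thesis
    using bij_betw_trans[OF f(1) g(1)] f(2,3) g(2,3)
    unfolding module_isomorphic_def by (intro exI[of _ "g \<circ> f"]) simp
qed

lemma vec_expansion:
  assumes "u \<in> vec_space d"
  shows "u = (\<Sum>i\<le>d. vscale (Poly_Mapping.lookup u i) (basis_vec i))"
proof (rule poly_mapping_eqI)
  fix k
  have lookup_sum: "Poly_Mapping.lookup (\<Sum>i\<in>A. f i) k = (\<Sum>i\<in>A. Poly_Mapping.lookup (f i) k)"
    for A :: "nat set" and f :: "nat \<Rightarrow> 'a vec"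
    by (induction A rule: infinite_finite_induct) (auto simp: lookup_add)
  have "Poly_Mapping.lookup u k = 0" if "k > d"
    using assms that by (force simp: vec_space_def in_keys_iff)
  then show "Poly_Mapping.lookup u k
      = Poly_Mapping.lookup (\<Sum>i\<le>d. vscale (Poly_Mapping.lookup u i) (basis_vec i)) k"
    by (simp add: lookup_sum basis_vec_def lookup_single when_def if_distrib[of "(*) _"] not_le
        cong: if_cong)
qed

lemma (in operator_images) alg_act_gen_eq: "alg_act T (gen_alg g) u = linear_ext d (img g) u"
  by (simp add: gen_alg.abs_eq alg_act_abs free_act_gen T_def)

context alg_module
begin

text \<open>The candidate isomorphism from the coordinate space to \<open>V\<close>, determined by
  the images \<open>u i\<close> of the basis vectors.\<close>

definition lincomb :: "nat \<Rightarrow> (nat \<Rightarrow> 'v) \<Rightarrow> 'k vec \<Rightarrow> 'v" where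
  "lincomb d u w = (\<Sum>i\<le>d. scale (Poly_Mapping.lookup w i) (u i))"

context
  fixes d and u :: "nat \<Rightarrow> 'v"
  assumes u: "\<And>i. i \<le> d \<Longrightarrow> u i \<in> V"
begin

lemma lincomb_closed: "lincomb d u w \<in> V"
  unfolding lincomb_def by (intro sum_closed scale_closed u) simp

lemma lincomb_0: "lincomb d u 0 = 0"
  by (simp add: lincomb_def scale_simps u)

lemma lincomb_add: "lincomb d u (w + w') = lincomb d u w + lincomb d u w'"
  by (simp add: lincomb_def lookup_add scale_add_left u sum.distrib)

lemma lincomb_vscale: "lincomb d u (vscale c w) = scale c (lincomb d u w)"
  unfolding lincomb_def by (subst scale_sum_right) (auto simp: scale_simps(4) scale_closed u)

lemma lincomb_sum: "lincomb d u (\<Sum>i\<in>A. f i) = (\<Sum>i\<in>A. lincomb d u (f i))"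
  by (induction A rule: infinite_finite_induct) (auto simp: lincomb_0 lincomb_add)

lemma lincomb_vec_B:
  "lincomb d u (vec_B d j) = (if 0 \<le> j \<and> j \<le> int d then u (nat j) else 0)"
proof -
  have "lincomb d u (vec_B d j) = (\<Sum>i\<le>d. if j = int i then u i else 0)"
    unfolding lincomb_def by (intro sum.cong refl) (auto simp: lookup_vec_B scale_simps u)
  also have "\<dots> = (\<Sum>i\<le>d. if i = nat j \<and> 0 \<le> j then u i else 0)"
    by (intro sum.cong refl) auto
  also have "\<dots> = (if 0 \<le> j \<and> j \<le> int d then u (nat j) else 0)"
    by (cases "0 \<le> j") (auto simp: nat_le_iff)
  finally show ?thesis .
qed

lemma lincomb_vec_AB:
  "lincomb d u (vec_AB d j) =
     (if j = int d + 1 then u d else if 0 \<le> j \<and> j \<le> int d then u (nat j) else 0)"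
proof -
  have "basis_vec d = (vec_B d (int d) :: 'k vec)" by (simp add: vec_B_def)
  then show ?thesis by (simp add: vec_AB_def lincomb_vec_B)
qed

text \<open>\<open>lincomb d u\<close> commutes with the generators and hence with the algebra. It
  is injective because the \<open>u i\<close> are nonzero eigenvectors for distinct eigenvalues, and
  surjective because its image is a nonzero submodule of an irreducible module.\<close>

lemma isomorphic_if_eigenbasis:
  assumes irr: "irreducible_module V act"
    and img: "operator_images d img"
    and nz: "\<And>i. i \<le> d \<Longrightarrow> u i \<noteq> 0"
    and eigen: "\<And>i. i \<le> d \<Longrightarrow> act a (u i) = scale (l i) (u i)" "inj_on l {..d}"
    and gens: "\<And>g i. i \<le> d \<Longrightarrow> act (gen_alg g) (u i) = lincomb d u (img g i)"
  shows "module_isomorphic V act (vec_space d) (alg_act (operator_images.T d img))"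
proof -
  interpret op: operator_images d img by fact
  interpret W: left_module "vec_space d" "alg_act op.T" by (rule op.left_module_vec_space)
  have hom: "\<forall>w\<in>vec_space d. lincomb d u (alg_act op.T b w) = act b (lincomb d u w)" for b
  proof (induction b rule: alg_induct)
    case (scalar c)
    show ?case by (simp add: op.alg_act_scalar lincomb_vscale scale_simps(5) lincomb_closed)
  next
    case (gen g)
    show ?case
    proof
      fix w
      have "lincomb d u (alg_act op.T (gen_alg g) w)
          = (\<Sum>i\<le>d. scale (Poly_Mapping.lookup w i) (act (gen_alg g) (u i)))"
        by (simp add: op.alg_act_gen_eq linear_ext_def lincomb_sum lincomb_vscale gens)
      also have "\<dots> = act (gen_alg g) (lincomb d u w)"
        unfolding lincomb_def by (subst act_sum_right) (auto simp: scale_closed u act_scale)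
      finally show "lincomb d u (alg_act op.T (gen_alg g) w) = act (gen_alg g) (lincomb d u w)" .
    qed
  qed (simp_all add: W.act_add_left lincomb_add act_add_left lincomb_closed W.act_mult act_mult
      W.act_closed)
  have inj: "w = 0" if w: "w \<in> vec_space d" "lincomb d u w = 0" for w
  proof -
    have term0: "scale (Poly_Mapping.lookup w i) (u i) = 0" if "i \<le> d" for i
    proof (rule eigenvectors_independent[where a = a and l = l])
      show "(\<Sum>i\<le>d. scale (Poly_Mapping.lookup w i) (u i)) = 0"
        using w(2) by (simp add: lincomb_def)
    qed (use that eigen in \<open>simp_all add: u scale_closed act_scale scale_simps(4) mult.commute\<close>)
    have "Poly_Mapping.lookup w i = 0" if "i \<le> d" for i
      using term0[OF that] that nz[of i] by (simp add: scale_eq_0_iff u)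
    then show "w = 0" using vec_expansion[OF w(1)] by (simp add: vscale_simps)
  qed
  have "inj_on (lincomb d u) (vec_space d)"
  proof (rule inj_onI)
    fix w w' assume w: "w \<in> vec_space d" "w' \<in> vec_space d" "lincomb d u w = lincomb d u w'"
    have "lincomb d u (w - w') = 0"
      using lincomb_add[of "w - w'" w'] w(3) by simp
    then show "w = w'" using inj[of "w - w'"] W.diff_closed[OF w(1,2)] by simp
  qed
  moreover have "lincomb d u ` vec_space d = V"
  proof -
    have "left_submodule (lincomb d u ` vec_space d) V act"
      unfolding left_submodule_def
    proof (intro conjI ballI allI)
      show "0 \<in> lincomb d u ` vec_space d" using lincomb_0 W.zero_closed by (metis imageI)
      fix v v' b assume "v \<in> lincomb d u ` vec_space d"
      then obtain w where w: "v = lincomb d u w" "w \<in> vec_space d" by blast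
      have "act b v = lincomb d u (alg_act op.T b w)" using hom w by simp
      then show "act b v \<in> lincomb d u ` vec_space d" using W.act_closed[OF w(2)] by blast
      assume "v' \<in> lincomb d u ` vec_space d"
      then obtain w' where w': "v' = lincomb d u w'" "w' \<in> vec_space d" by blast
      have "v + v' = lincomb d u (w + w')" by (simp add: w w' lincomb_add)
      then show "v + v' \<in> lincomb d u ` vec_space d" using W.add_closed[OF w(2) w'(2)] by blast
    qed (use lincomb_closed in blast)
    moreover have "u 0 \<in> lincomb d u ` vec_space d"
      using lincomb_vec_B[of 0] by (intro image_eqI[OF _ vec_B_closed[of d 0]]) simp
    ultimately show ?thesis
      using irr nz[of 0] unfolding irreducible_module_def by auto
  qed
  ultimately have "module_isomorphic (vec_space d) (alg_act op.T) V act"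
    unfolding module_isomorphic_def bij_betw_def using hom lincomb_add by blast
  then show ?thesis by (rule module_isomorphic_sym[OF op.left_module_vec_space])
qed

end

end

context ladder
begin

text \<open>Indices of equal parity give equal eigenvalues only if they coincide; indices of
  opposite parity only if they add up to \<open>N\<close>. The comparison is made in the integers,
  using characteristic zero.\<close>

lemma eigenvalues_distinct:
  assumes "c = of_nat N" "\<And>i j. i \<le> d \<Longrightarrow> j \<le> d \<Longrightarrow> odd (i + j) \<Longrightarrow> i + j \<noteq> N"
  shows "inj_on (\<lambda>i. (-1) ^ i * (c - 2 * of_nat i)) {..d}"
proof (rule inj_onI)
  fix i j assume ij: "i \<in> {..d}" "j \<in> {..d}"
    and eq: "(-1) ^ i * (c - 2 * of_nat i) = (-1) ^ j * (c - 2 * of_nat j)"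
  have "of_int ((-1) ^ i * (int N - 2 * int i)) = (of_int ((-1) ^ j * (int N - 2 * int j)) :: 'k)"
    using eq by (simp add: assms(1))
  then have eq': "(-1) ^ i * (int N - 2 * int i) = (-1) ^ j * (int N - 2 * int j)"
    by (simp only: of_int_eq_iff)
  show "i = j"
  proof (cases "odd (i + j)")
    case True
    then have "(-1) ^ i = (- ((-1) ^ j) :: int)" by (cases "even i") auto
    with eq' have "(-1) ^ j * (int N - 2 * int j + (int N - 2 * int i)) = 0" by (simp add: algebra_simps)
    then have "i + j = N" by simp
    with True assms(2)[of i j] ij show ?thesis by simp
  next
    case False
    then have "(-1) ^ i = ((-1) ^ j :: int)" by (cases "even i") auto
    with eq' show ?thesis by simp
  qed
qed

lemma isomorphic_type_B:
  assumes irr: "irreducible_module V act"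
    and XYZ: "X = gen_alg Gx" "Y = gen_alg Gy" "Z = gen_alg Gz" and c: "c = of_nat d"
    and "even d" and u0: "u 0 \<noteq> 0" and top: "u (Suc d) = 0"
  shows "module_isomorphic V act (type_space (TypeB d)) (type_act (TypeB d))"
proof -
  note lin = lincomb_add[of d u, OF u_closed] lincomb_vscale[of d u, OF u_closed]
    lincomb_vec_B[of d u, OF u_closed]
  have low: "lincomb d u (vec_B d (int i - 1)) = (if i = 0 then 0 else u (i - 1))" if "i \<le> d" for i
    using that lin(3)[of "int i - 1"] by (cases i) auto
  \<comment> \<open>At \<open>i = d\<close> the convention of \<open>vec_B\<close> for index
    \<open>d + 1\<close> matches the hypothesis \<open>top\<close>.\<close>
  have high: "lincomb d u (vec_B d (int i + 1)) = u (Suc i)" if "i \<le> d" for i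
    using that top lin(3)[of "int i + 1"] by (cases "i = d") (auto simp: nat_add_distrib)
  have "act (gen_alg g) (u i) = lincomb d u (image_B d g i)" if "i \<le> d" for g i
  proof (cases g)
    case Gx
    then show ?thesis using that act_X[of i] by (simp add: lin XYZ c)
  next
    case Gy
    then show ?thesis using that act_YZ(1)[of i]
      by (simp add: lin XYZ c low[OF that] high[OF that])
  next
    case Gz
    then show ?thesis using that act_YZ(2)[of i]
      by (simp add: lin XYZ c low[OF that] high[OF that] minus_one_powi)
  qed
  moreover have "inj_on (\<lambda>i. (-1) ^ i * (c - 2 * of_nat i)) {..d}"
    \<comment> \<open>An odd sum of indices cannot equal the even number \<open>d\<close>.\<close>
    using \<open>even d\<close> by (intro eigenvalues_distinct[OF c]) auto
  moreover have ne: "c \<noteq> of_nat i" if "i < d" for i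
    unfolding c of_nat_eq_iff using that by simp
  ultimately show ?thesis
    unfolding type_space.simps type_act_eq_T
    using nonzero[OF u0 ne]
    by (intro isomorphic_if_eigenbasis[OF _ irr operator_images_B _ act_X]) (auto simp: u_closed)
qed

text \<open>The signs in the formulas of \<open>image_AB\<close> are absorbed into X, Y, Z, after
  which the ladder formulas for \<open>c = 2 d + 1\<close> remain. The hypothesis \<open>top\<close>
  is the convention that index \<open>d + 1\<close> repeats index \<open>d\<close>.\<close>

lemma isomorphic_type_AB:
  assumes irr: "irreducible_module V act"
    and X: "X = scalar (label_sign Gx n * (-1) ^ d) * gen_alg Gx"
    and Y: "Y = scalar (label_sign Gy n * (-1) ^ d) * gen_alg Gy"
    and Z: "Z = scalar (label_sign Gz n) * gen_alg Gz"
    and c: "c = of_nat (2 * d + 1)" and u0: "u 0 \<noteq> 0" and top: "u (Suc d) = u d"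
  shows "module_isomorphic V act (type_space (TypeAB d n)) (type_act (TypeAB d n))"
proof -
  note lin = lincomb_add[of d u, OF u_closed] lincomb_vscale[of d u, OF u_closed]
    lincomb_vec_AB[of d u, OF u_closed]
  \<comment> \<open>A sign is its own inverse, so it can be moved from the operator to the
    result.\<close>
  have untwist: "act a v = scale s w" if "act (scalar s * a) v = w" "v \<in> V" "s * s = 1" for s a v w
    using that by (auto simp: act_scalar_mult act_closed scale_simps)
  have signs: "label_sign g n * (-1) ^ d * (label_sign g n * (-1) ^ d) = (1 :: 'k)" for g
    using label_sign_simps(2)[of g n] minus_one_power_square(1)[of d]
    by (metis (no_types, lifting) mult.assoc mult.commute mult_1)
  have low: "lincomb d u (vec_AB d (int i - 1)) = (if i = 0 then 0 else u (i - 1))" if "i \<le> d" for i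
    using that lin(3)[of "int i - 1"] by (cases i) auto
  have high: "lincomb d u (vec_AB d (int i + 1)) = u (Suc i)" if "i \<le> d" for i
    using that top lin(3)[of "int i + 1"] by (cases "i = d") (auto simp: nat_add_distrib)
  have c': "c - of_nat i + 1 = 2 * of_nat d - of_nat i + 2" for i
    by (simp add: c)
  have "act (gen_alg g) (u i) = lincomb d u (image_AB d n g i)" if i: "i \<le> d" for g i
  proof (cases g)
    case Gx
    show ?thesis unfolding Gx using i untwist[OF act_X[OF i, unfolded X] u_closed signs]
      by (simp add: lin c scale_simps u_closed power_add algebra_simps)
  next
    case Gy
    show ?thesis
      unfolding Gy untwist[OF act_YZ(1)[OF i, unfolded Y] u_closed[OF le_SucI[OF i]] signs]
      by (simp only: image_AB.simps lin low[OF i] high[OF i] c')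
  next
    case Gz
    show ?thesis
      unfolding Gz untwist[OF act_YZ(2)[OF i, unfolded Z] u_closed[OF le_SucI[OF i]] label_sign_simps(2)]
      by (simp only: image_AB.simps lin low[OF i] high[OF i] c' minus_one_powi)
  qed
  moreover have "inj_on (\<lambda>i. (-1) ^ i * (c - 2 * of_nat i)) {..d}"
    by (intro eigenvalues_distinct[OF c]) auto
  moreover have ne: "c \<noteq> of_nat i" if "i < d" for i
    unfolding c of_nat_eq_iff using that by simp
  ultimately show ?thesis
    unfolding type_space.simps type_act_eq_T
    using nonzero[OF u0 ne]
    by (intro isomorphic_if_eigenbasis[OF _ irr operator_images_AB _ act_X]) (auto simp: u_closed)
qed

end

section \<open>Uniqueness of the type\<close>

lemma of_int_eq_imp_eq: "(of_int a :: 'k::field_char_0) = of_int b \<Longrightarrow> a = b"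
  by (simp only: of_int_eq_iff)

lemma lookup_sum_vec_B:
  assumes "k \<le> d"
  shows "Poly_Mapping.lookup (\<Sum>i\<le>d. vscale (f i) (vec_B d (int i))) k = f k"
proof -
  have "Poly_Mapping.lookup (\<Sum>i\<in>A. h i) k = (\<Sum>i\<in>A. Poly_Mapping.lookup (h i) k)"
    for A :: "nat set" and h :: "nat \<Rightarrow> 'a vec"
    by (induction A rule: infinite_finite_induct) (auto simp: lookup_add)
  then show ?thesis
    using assms by (simp add: lookup_vec_B if_distrib[of "(*) _"] cong: if_cong)
qed

section \<open>Eigenvalues of x on the listed modules\<close>

fun type_eigenvalue :: "module_type \<Rightarrow> nat \<Rightarrow> 'k::field" where
  "type_eigenvalue (TypeB d) i = (-1) ^ i * (of_nat d - 2 * of_nat i)"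
| "type_eigenvalue (TypeAB d n) i =
     label_sign Gx n * (-1) ^ (d + i) * (2 * of_nat d - 2 * of_nat i + 1)"

fun type_degree :: "module_type \<Rightarrow> nat" where
  "type_degree (TypeB d) = d" | "type_degree (TypeAB d n) = d"

lemma type_space_degree: "type_space t = vec_space (type_degree t)"
  by (cases t) simp_all

lemma type_act_gen_eq:
  "type_act (TypeB d) (gen_alg g) u = linear_ext d (image_B d g) u"
  "type_act (TypeAB d n) (gen_alg g) u = linear_ext d (image_AB d n g) u"
  unfolding type_act_eq_T operator_images.alg_act_gen_eq[OF operator_images_B]
    operator_images.alg_act_gen_eq[OF operator_images_AB] by (rule refl)+

lemma vec_AB_eq_vec_B: "i \<le> d \<Longrightarrow> vec_AB d (int i) = vec_B d (int i)"
  by (simp add: vec_AB_def)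

declare type_act.simps [simp del]

lemma lookup_type_act_Gx:
  assumes "k \<le> type_degree t"
  shows "Poly_Mapping.lookup (type_act t (gen_alg Gx) u) k = type_eigenvalue t k * Poly_Mapping.lookup u k"
proof -
  have "type_act t (gen_alg Gx) u = (\<Sum>i\<le>type_degree t.
      vscale (type_eigenvalue t i * Poly_Mapping.lookup u i) (vec_B (type_degree t) (int i)))"
    by (cases t)
      (auto simp: type_act_gen_eq linear_ext_def vscale_simps vec_AB_eq_vec_B mult.commute
        intro!: sum.cong)
  then show ?thesis using assms by (simp add: lookup_sum_vec_B)
qed

text \<open>x is diagonal in the given basis, so an eigenvector has nonzero coordinates only at
  indices carrying its eigenvalue.\<close>

lemma type_eigenvector_support:
  assumes "w \<in> type_space t" "type_act t (gen_alg Gx) w = vscale l w" "Poly_Mapping.lookup w k \<noteq> 0"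
  shows "k \<le> type_degree t" "type_eigenvalue t k = l"
proof -
  show k: "k \<le> type_degree t"
    using assms(1,3) by (auto simp: type_space_degree vec_space_def in_keys_iff)
  show "type_eigenvalue t k = l"
    using lookup_type_act_Gx[OF k, of w] assms(2,3) by simp
qed

text \<open>The vector \<open>w\<close> is the image of \<open>v\<close>. Comparing two algebra
  elements on \<open>v\<close> covers eigenvector equations, by taking one of them to be a
  scalar.\<close>

lemma module_isomorphic_transport:
  assumes "left_module V act" "left_module W act'" "module_isomorphic V act W act'" "v \<in> V" "v \<noteq> 0"
  obtains w where "w \<in> W" "w \<noteq> 0" "\<And>a b. act a v = act b v \<Longrightarrow> act' a w = act' b w"
proof -
  interpret V: left_module V act by fact
  interpret W: left_module W act' by fact
  obtain f where f: "bij_betw f V W" "\<And>u v. u \<in> V \<Longrightarrow> v \<in> V \<Longrightarrow> f (u + v) = f u + f v"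
    "\<And>a u. u \<in> V \<Longrightarrow> f (act a u) = act' a (f u)"
    using assms(3) unfolding module_isomorphic_def by blast
  have "f 0 = 0" using f(2)[of 0 0] V.zero_closed by simp
  then have "f v \<noteq> 0"
    using f(1) assms(4,5) V.zero_closed by (metis bij_betw_imp_inj_on inj_onD)
  moreover have "f v \<in> W" using f(1) assms(4) by (auto simp: bij_betw_def)
  moreover have "act' a (f v) = act' b (f v)" if "act a v = act b v" for a b
    using that f(3)[OF assms(4)] by metis
  ultimately show thesis by (intro that)
qed

lemma type_transport:
  fixes v :: "'k::field vec"
  assumes "module_isomorphic (type_space t :: 'k vec set) (type_act t) (type_space t') (type_act t')"
    and "v \<in> type_space t" "v \<noteq> 0"
  obtains w :: "'k vec" where "w \<in> type_space t'" "w \<noteq> 0"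
    "\<And>a c. type_act t a v = vscale c v \<Longrightarrow> type_act t' a w = vscale c w"
proof -
  obtain w where w: "w \<in> type_space t'" "w \<noteq> 0"
      "\<And>a b. type_act t a v = type_act t b v \<Longrightarrow> type_act t' a w = type_act t' b w"
    using module_isomorphic_transport[OF left_module_type left_module_type assms(1-3)] by blast
  have "type_act t' a w = vscale c w" if "type_act t a v = vscale c v" for a c
    using w(3)[of a "scalar c"] that by (simp add: type_act_scalar)
  then show thesis by (intro that[OF w(1,2)])
qed

lemma basis_vec_in_space: "i \<le> d \<Longrightarrow> basis_vec i \<in> vec_space d"
  by (simp add: basis_vec_def vec_space_def)

lemma basis_vec_nonzero: "basis_vec i \<noteq> (0 :: 'k::field vec)"
proof
  assume "basis_vec i = (0 :: 'k vec)"
  then have "Poly_Mapping.lookup (basis_vec i :: 'k vec) i = 0" by simp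
  then show False by (simp add: basis_vec_def)
qed

lemma eigenvalue_transport:
  assumes "module_isomorphic (type_space t :: 'k::field vec set) (type_act t) (type_space t') (type_act t')"
    and "i \<le> type_degree t"
  obtains k where "k \<le> type_degree t'" "type_eigenvalue t' k = (type_eigenvalue t i :: 'k)"
proof -
  have "type_act t (gen_alg Gx) (basis_vec i) = vscale (type_eigenvalue t i) (basis_vec i :: 'k vec)"
    using assms(2) by (cases t) (simp_all add: type_act_gen vec_AB_def vec_B_def)
  moreover have "basis_vec i \<in> type_space t"
    using assms(2) by (simp add: type_space_degree basis_vec_in_space)
  ultimately obtain w :: "'k vec" where w: "w \<in> type_space t'" "w \<noteq> 0"
    "type_act t' (gen_alg Gx) w = vscale (type_eigenvalue t i) w"
    using type_transport[OF assms(1) _ basis_vec_nonzero, of i] by metis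
  from w(2) obtain k where "Poly_Mapping.lookup w k \<noteq> 0"
    by (metis poly_mapping_eqI lookup_zero)
  from that[OF type_eigenvector_support[OF w(1,3) this]] show thesis .
qed

text \<open>The eigenvalue \<open>d\<close> of the bottom vector must occur in the other module,
  whose eigenvalues have absolute value at most \<open>d'\<close>.\<close>

lemma type_B_degree_le:
  assumes "module_isomorphic (type_space (TypeB d) :: 'k::field_char_0 vec set) (type_act (TypeB d))
    (type_space (TypeB d')) (type_act (TypeB d'))"
  shows "d \<le> d'"
proof -
  obtain k where k: "k \<le> d'" "type_eigenvalue (TypeB d') k = (type_eigenvalue (TypeB d) 0 :: 'k)"
    using eigenvalue_transport[OF assms, of 0] by auto
  have "(of_int ((-1) ^ k * (int d' - 2 * int k)) :: 'k) = of_int (int d)"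
    using k(2) by simp
  then have "(-1) ^ k * (int d' - 2 * int k) = int d" by (rule of_int_eq_imp_eq)
  then show ?thesis using k(1) by (cases "even k") auto
qed

text \<open>x has an even eigenvalue on the first module and only odd ones on the second; squaring
  removes the signs.\<close>

lemma type_B_not_AB:
  assumes "even d"
  shows "\<not> module_isomorphic (type_space (TypeB d) :: 'k::field_char_0 vec set) (type_act (TypeB d))
    (type_space (TypeAB d' n)) (type_act (TypeAB d' n))"
proof
  assume iso: "module_isomorphic (type_space (TypeB d) :: 'k vec set) (type_act (TypeB d))
    (type_space (TypeAB d' n)) (type_act (TypeAB d' n))"
  obtain k where "type_eigenvalue (TypeAB d' n) k = (type_eigenvalue (TypeB d) 0 :: 'k)"
    using eigenvalue_transport[OF iso, of 0] by auto
  then have "label_sign Gx n * (-1) ^ (d' + k) * (2 * of_nat d' - 2 * of_nat k + 1) = (of_nat d :: 'k)"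
    by simp
  then have "(label_sign Gx n * (-1) ^ (d' + k) * (2 * of_nat d' - 2 * of_nat k + 1))\<^sup>2
      = (of_nat d :: 'k)\<^sup>2"
    by simp
  moreover have "(label_sign Gx n :: 'k)\<^sup>2 = 1"
    by (simp add: power2_eq_square label_sign_simps)
  ultimately have "(of_int ((2 * int d' - 2 * int k + 1)\<^sup>2) :: 'k) = of_int ((int d)\<^sup>2)"
    by (simp add: power_mult_distrib power_mult[symmetric])
  then have "(2 * int d' - 2 * int k + 1)\<^sup>2 = (int d)\<^sup>2" by (rule of_int_eq_imp_eq)
  then have "even ((2 * int d' - 2 * int k + 1)\<^sup>2)" using assms by simp
  then show False by simp
qed

text \<open>The top basis vector of \<open>AB(d, n)\<close> spans the eigenspace of \<open>x\<close> for the only eigenvalue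
  \<open>\<plusminus>1\<close>; with that sign, \<open>y \<plusminus> z\<close> acts on it by a scalar which together with the eigenvalue
  determines \<open>d\<close> and \<open>n\<close>.\<close>

lemma type_AB_top:
  "type_act (TypeAB d n) (gen_alg Gx) (basis_vec d) = vscale (label_sign Gx n) (basis_vec d :: 'k::field vec)"
  "type_act (TypeAB d n) (gen_alg Gy + scalar (label_sign Gx n) * gen_alg Gz) (basis_vec d)
     = vscale (2 * label_sign Gy n * (-1) ^ d * (of_nat d + 1)) (basis_vec d :: 'k vec)"
proof -
  interpret left_module "type_space (TypeAB d n) :: 'k vec set" "type_act (TypeAB d n)"
    by (rule left_module_type)
  have e: "basis_vec d \<in> type_space (TypeAB d n)" by (simp add: basis_vec_in_space)
  show "type_act (TypeAB d n) (gen_alg Gx) (basis_vec d) = vscale (label_sign Gx n) (basis_vec d :: 'k vec)"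
    by (simp add: type_act_gen vec_AB_def vec_B_def minus_one_power_square power_add)
  show "type_act (TypeAB d n) (gen_alg Gy + scalar (label_sign Gx n) * gen_alg Gz) (basis_vec d)
     = vscale (2 * label_sign Gy n * (-1) ^ d * (of_nat d + 1)) (basis_vec d :: 'k vec)"
    \<comment> \<open>The sign of z times that of x is the sign of y, so the terms of index
      \<open>d - 1\<close> cancel and those of index \<open>d\<close> double.\<close>
    unfolding act_add_left[OF e] act_mult[OF e] type_act_scalar type_act_gen(2)[OF le_refl]
    by (rule poly_mapping_eqI)
      (auto simp: lookup_add lookup_vec_AB minus_one_powi basis_vec_def lookup_single when_def
        label_sign_simps algebra_simps)
qed

lemma label_eq_iff:
  "n = n' \<longleftrightarrow> label_sign Gx n = (label_sign Gx n' :: 'k::field_char_0)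
     \<and> label_sign Gy n = (label_sign Gy n' :: 'k)"
proof -
  have "m \<in> {None, Some Gx, Some Gy, Some Gz}" for m :: "gen option"
  proof (cases m)
    case (Some g)
    then show ?thesis by (cases g) auto
  qed simp
  from this[of n] this[of n'] show ?thesis by (auto simp: label_sign_def)
qed

text \<open>The image \<open>w\<close> of the top vector is a multiple of the top vector of the
  second module. Comparing the eigenvalues of x and of \<open>?s\<close> on it gives both signs and
  the degree.\<close>

lemma type_AB_eq:
  assumes "module_isomorphic (type_space (TypeAB d n) :: 'k::field_char_0 vec set) (type_act (TypeAB d n))
    (type_space (TypeAB d' n')) (type_act (TypeAB d' n'))"
  shows "d = d' \<and> n = n'"
proof -
  let ?a = "label_sign Gx n :: 'k"
  let ?s = "gen_alg Gy + scalar ?a * gen_alg Gz :: 'k alg"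
  have sq: "(label_sign g m :: 'k)\<^sup>2 = 1" for g m
    by (simp add: power2_eq_square label_sign_simps)
  obtain w :: "'k vec" where w: "w \<in> type_space (TypeAB d' n')" "w \<noteq> 0"
    and tr: "\<And>a c. type_act (TypeAB d n) a (basis_vec d) = vscale c (basis_vec d)
      \<Longrightarrow> type_act (TypeAB d' n') a w = vscale c w"
    using type_transport[OF assms, of "basis_vec d"] basis_vec_nonzero
    by (auto simp: basis_vec_in_space)
  note wx = tr[OF type_AB_top(1)] and ws = tr[OF type_AB_top(2)]
  have supp: "k = d'" "label_sign Gx n' = ?a" if k: "Poly_Mapping.lookup w k \<noteq> 0" for k
  proof -
    have "k \<le> d'" using type_eigenvector_support(1)[OF w(1) wx k] by simp
    have ev: "label_sign Gx n' * (-1) ^ (d' + k) * (2 * of_nat d' - 2 * of_nat k + 1) = ?a"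
      using type_eigenvector_support(2)[OF w(1) wx k] by simp
    then have "(label_sign Gx n' * (-1) ^ (d' + k) * (2 * of_nat d' - 2 * of_nat k + 1))\<^sup>2 = ?a\<^sup>2"
      by simp
    then have "(of_int ((2 * int d' - 2 * int k + 1)\<^sup>2) :: 'k) = of_int 1"
      by (simp add: power_mult_distrib power_mult[symmetric] sq)
    then have "(2 * int d' - 2 * int k + 1)\<^sup>2 = 1" by (rule of_int_eq_imp_eq)
    \<comment> \<open>The root -1 would give \<open>k = d' + 1\<close>, beyond the degree.\<close>
    then show "k = d'" using \<open>k \<le> d'\<close> by (auto simp: power2_eq_1_iff)
    then show "label_sign Gx n' = ?a" using ev by (simp add: power_add minus_one_power_square)
  qed
  from w(2) obtain k where "Poly_Mapping.lookup w k \<noteq> 0"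
    by (metis poly_mapping_eqI lookup_zero)
  with supp have wd: "Poly_Mapping.lookup w d' \<noteq> 0" and a: "label_sign Gx n' = ?a" by auto
  let ?c = "Poly_Mapping.lookup w d'"
  have "w = vscale ?c (basis_vec d')"
    using supp by (intro poly_mapping_eqI) (auto simp: basis_vec_def lookup_single when_def)
  moreover interpret alg_module "type_space (TypeAB d' n') :: 'k vec set" "type_act (TypeAB d' n')"
    by (intro alg_module.intro left_module_type)
  have "type_act (TypeAB d' n') ?s (vscale ?c (basis_vec d'))
      = vscale ?c (type_act (TypeAB d' n') ?s (basis_vec d'))"
    using act_scale[of "basis_vec d'" ?s ?c]
    by (simp only: scale_def type_act_scalar) (simp add: basis_vec_in_space)
  ultimately have "type_act (TypeAB d' n') ?s w
      = vscale ?c (vscale (2 * label_sign Gy n' * (-1) ^ d' * (of_nat d' + 1)) (basis_vec d'))"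
    using type_AB_top(2)[of d' n'] a by metis
  then have "Poly_Mapping.lookup (vscale (2 * label_sign Gy n * (-1) ^ d * (of_nat d + 1)) w) d'
      = ?c * (2 * label_sign Gy n' * (-1) ^ d' * (of_nat d' + 1))"
    using ws by (simp add: basis_vec_def)
  then have eq: "label_sign Gy n * (-1) ^ d * (of_nat d + 1)
      = label_sign Gy n' * (-1) ^ d' * (of_nat d' + 1 :: 'k)"
    using wd by (simp add: mult.assoc)
  \<comment> \<open>Squaring isolates the degree; the sign of y then follows by cancelling
    \<open>of_nat d' + 1\<close>.\<close>
  then have "(label_sign Gy n * (-1) ^ d * (of_nat d + 1))\<^sup>2
      = (label_sign Gy n' * (-1) ^ d' * (of_nat d' + 1 :: 'k))\<^sup>2"
    by simp
  then have "(of_int ((int d + 1)\<^sup>2) :: 'k) = of_int ((int d' + 1)\<^sup>2)"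
    by (simp add: power_mult_distrib power_mult[symmetric] sq)
  then have "(int d + 1)\<^sup>2 = (int d' + 1)\<^sup>2" by (rule of_int_eq_imp_eq)
  then have d: "d = d'" by (simp add: power2_eq_iff)
  have "(of_nat d' + 1 :: 'k) \<noteq> 0"
    by (metis of_nat_Suc of_nat_neq_0 add.commute)
  with eq have "label_sign Gy n = (label_sign Gy n' :: 'k)" by (simp add: d)
  with a d show ?thesis by (simp add: label_eq_iff[of n n', where 'k = 'k])
qed

lemma listed_type_unique:
  assumes iso: "module_isomorphic (type_space t :: 'k::field_char_0 vec set) (type_act t)
      (type_space t') (type_act t')"
    and listed: "t \<in> listed_types" "t' \<in> listed_types"
  shows "t = t'"
proof -
  have iso': "module_isomorphic (type_space t' :: 'k vec set) (type_act t') (type_space t) (type_act t)"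
    by (rule module_isomorphic_sym[OF left_module_type iso])
  show ?thesis
  proof (cases t)
    case (TypeB d)
    show ?thesis
    proof (cases t')
      fix d' assume "t' = TypeB d'"
      then show ?thesis
        using type_B_degree_le[of d d', where 'k = 'k] type_B_degree_le[of d' d, where 'k = 'k]
          iso iso' TypeB by simp
    next
      fix d' n assume "t' = TypeAB d' n"
      then show ?thesis
        using type_B_not_AB[of d d' n, where 'k = 'k] iso listed TypeB
        by (auto simp: listed_types_def simp del: type_space.simps type_act.simps)
    qed
  next
    case (TypeAB d n)
    show ?thesis
    proof (cases t')
      fix d' assume "t' = TypeB d'"
      then show ?thesis
        using type_B_not_AB[of d' d n, where 'k = 'k] iso' listed TypeAB
        by (auto simp: listed_types_def simp del: type_space.simps type_act.simps)
    next
      fix d' n' assume "t' = TypeAB d' n'"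
      then show ?thesis
        using type_AB_eq[of d n d' n', where 'k = 'k] iso TypeAB by simp
    qed
  qed
qed

section \<open>Existence of the type\<close>

lemma scalar_mult_mult: "scalar a * p * (scalar b * q) = scalar (a * b) * (p * q)"
  by (simp add: scalar_mult mult.assoc) (metis mult.assoc scalar_commute)

text \<open>Each of the signs a, b, ab is the product of the other two, so both sides of every
  relation acquire the same sign.\<close>

lemma spin_triple_signs:
  assumes "a * a = 1" "b * b = 1"
  shows "spin_triple (scalar a * gen_alg Gx) (scalar b * gen_alg Gy) (scalar (a * b) * gen_alg Gz)"
proof
  have [simp]: "scalar c * (2 * p) = 2 * (scalar c * p)" for c and p :: "'a alg"
    by (simp add: mult_2 distrib_left)
  have ab: "a * b * a = b" "b * (a * b) = a" "a * (a * b) = b" "a * b * b = a"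
    using assms by (metis mult.assoc mult.commute mult_1)+
  let ?x = "gen_alg Gx" and ?y = "gen_alg Gy" and ?z = "gen_alg Gz"
  show "scalar a * ?x * (scalar b * ?y) + scalar b * ?y * (scalar a * ?x) = 2 * (scalar (a * b) * ?z)"
    by (simp add: scalar_mult_mult mult.commute[of b a] gen_alg_relations flip: distrib_left)
  show "scalar b * ?y * (scalar (a * b) * ?z) + scalar (a * b) * ?z * (scalar b * ?y) = 2 * (scalar a * ?x)"
    by (simp add: scalar_mult_mult ab gen_alg_relations flip: distrib_left)
  show "scalar (a * b) * ?z * (scalar a * ?x) + scalar a * ?x * (scalar (a * b) * ?z) = 2 * (scalar b * ?y)"
    by (simp add: scalar_mult_mult ab gen_alg_relations flip: distrib_left)
qed

text \<open>Negating Y and Z negates every step, and alternating the signs of the vectors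
  compensates. For odd \<open>N\<close>, folding the alternated ladder yields differences, up to
  sign, in place of sums.\<close>

lemma (in ladder) ladder_alternate:
  "ladder V act X (- Y) (- Z) d c (\<lambda>i. scale ((-1) ^ i) (u i))"
proof -
  interpret alt: spin_module V act X "- Y" "- Z"
    by (intro spin_module.intro sign_change alg_module_axioms)
  have step: "alt.step i = - step i" for i
    by (simp add: alt.step_def step_def)
  have s: "act (alt.step i) (scale ((-1) ^ j) (u j)) = scale (- ((-1) ^ j)) (act (step i) (u j))"
    if "j \<le> Suc d" for i j
    using u_closed[OF that]
    by (simp add: step act_uminus_left scale_closed act_scale act_closed scale_uminus_left scale_uminus_right)
  show ?thesis
  proof
    fix i
    show "scale ((-1) ^ i) (u i) \<in> V" if "i \<le> Suc d"
      using u_closed[OF that] by (rule scale_closed)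
    show "act X (scale ((-1) ^ i) (u i)) = scale ((-1) ^ i * (c - 2 * of_nat i)) (scale ((-1) ^ i) (u i))"
      if "i \<le> d"
      using that u_closed[of i] by (simp add: act_scale act_X scale_simps(4) mult.commute)
    show "act (alt.step i) (scale ((-1) ^ i) (u i))
        = scale (2 * of_nat (Suc i)) (scale ((-1) ^ Suc i) (u (Suc i)))" if "i \<le> d"
      using that u_closed[of "Suc i"] by (simp add: s step_up scale_simps(4) mult.commute del: of_nat_Suc)
    show "act (alt.step i) (scale ((-1) ^ Suc i) (u (Suc i)))
        = scale (2 * (c - of_nat i)) (scale ((-1) ^ i) (u i))" if "i < d"
      using that u_closed[of i]
      by (subst s) (simp_all add: step_down scale_simps(4) mult.commute)
    show "act (alt.step 1) (scale ((-1) ^ 0) (u 0)) = 0"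
      by (subst s) (simp_all add: step_bottom[simplified] scale_simps(3))
  qed
qed

section \<open>Termination of ladders\<close>

locale finite_dimensional_spin_module =
  spin_module V act X Y Z + finite_dimensional_alg_module V act
  for V :: "'v::ab_group_add set" and act :: "'k::field_char_0 alg \<Rightarrow> 'v \<Rightarrow> 'v" and X Y Z :: "'k alg"
begin

text \<open>Along even indices the sign is constant and the eigenvalues \<open>c - 4 k\<close> are
  distinct, so some term vanishes; \<open>m\<close> is an index just before a zero.\<close>

lemma eigenvector_sequence_stops:
  assumes "\<And>i. w i \<in> V" "\<And>i. act X (w i) = scale ((-1) ^ i * (c - 2 * of_nat i)) (w i)" "w 0 \<noteq> 0"
  obtains m where "w m \<noteq> 0" "w (Suc m) = 0"
proof -
  have "inj (\<lambda>k. c - 4 * of_nat k :: 'k)" by (rule injI) simp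
  moreover have "act X (w (2 * k)) = scale (c - 4 * of_nat k) (w (2 * k))" for k
    using assms(2)[of "2 * k"] by simp
  ultimately obtain k where k: "w (2 * k) = 0"
    using eigenvectors_vanish[of "\<lambda>k. w (2 * k)" X "\<lambda>k. c - 4 * of_nat k", OF assms(1)] by blast
  have "\<exists>m. w m \<noteq> 0 \<and> w (Suc m) = 0"
  proof (rule ccontr)
    assume "\<nexists>m. w m \<noteq> 0 \<and> w (Suc m) = 0"
    then have "w m \<noteq> 0" for m by (induction m) (use assms(3) in auto)
    with k show False by blast
  qed
  then show thesis using that by blast
qed

lemma step_annihilates_some_eigenvector:
  assumes "v \<in> V" "v \<noteq> 0" "act X v = scale c v"
  obtains w l m where "w \<in> V" "w \<noteq> 0" "act X w = scale l w" "act (step m) w = 0"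
proof -
  define w where "w = rec_nat v (\<lambda>i w. act (step i) w)"
  have w0: "w 0 = v" and wS: "w (Suc i) = act (step i) (w i)" for i
    by (simp_all add: w_def)
  have wV: "w i \<in> V" for i
    by (induction i) (simp_all add: w0 wS assms(1) act_closed)
  have wX: "act X (w i) = scale ((-1) ^ i * (c - 2 * of_nat i)) (w i)" for i
  proof (induction i)
    case (Suc i)
    have "(-1) ^ Suc i * (c - 2 * of_nat i - 2) = (-1) ^ Suc i * (c - 2 * of_nat (Suc i))"
      by (simp add: algebra_simps)
    then show ?case using act_X_step[OF wV Suc] by (simp only: wS)
  qed (simp add: w0 assms(3))
  obtain m where m: "w m \<noteq> 0" "w (Suc m) = 0"
    using eigenvector_sequence_stops[OF wV wX] assms(2) w0 by metis
  show thesis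
    using that[OF wV m(1) wX] m(2) by (simp only: wS)
qed

text \<open>Lowering the vanishing vector \<open>u (Suc N)\<close> gives
  \<open>2 * (c - of_nat N)\<close> times the nonzero \<open>u N\<close>, which forces the value of
  \<open>c\<close>.\<close>

lemma finite_ladder:
  assumes "v \<in> V" "v \<noteq> 0" "act X v = scale c v" "act (step 1) v = 0"
  obtains N u where "c = of_nat N" "ladder V act X Y Z N c u" "u 0 = v" "u N \<noteq> 0" "u (Suc N) = 0"
proof -
  obtain u where u0: "u 0 = v" and lad: "\<And>d. ladder V act X Y Z d c u"
    using ladder_from_bottom[OF assms(1,3,4)] by metis
  have uV: "u i \<in> V" for i
    by (rule ladder.u_closed[OF lad[of i]]) simp
  have uX: "act X (u i) = scale ((-1) ^ i * (c - 2 * of_nat i)) (u i)" for i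
    by (rule ladder.act_X[OF lad[of i]]) simp
  obtain N where N: "u N \<noteq> 0" "u (Suc N) = 0"
    using eigenvector_sequence_stops[OF uV uX] assms(2) u0 by metis
  have "scale (2 * (c - of_nat N)) (u N) = 0"
    using ladder.step_down[OF lad[of "Suc N"], of N] N(2) by simp
  then have "c = of_nat N"
    using N(1) uV by (simp add: scale_eq_0_iff)
  then show thesis using that lad u0 N by blast
qed

end


lemma label_with_signs:
  assumes "a \<in> {1, -1 :: 'k::field}" "b \<in> {1, -1}"
  obtains n where "label_sign Gx n = a" "label_sign Gy n = b"
proof -
  have "\<exists>n. label_sign Gx n = a \<and> label_sign Gy n = b"
    using assms
    by (intro exI[of _ "if a = 1 then if b = 1 then None else Some Gx
      else if b = 1 then Some Gy else Some Gz"]) (auto simp: label_sign_def)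
  then show thesis using that by blast
qed

lemma odd_ladder_isomorphic_type_AB:
  fixes act :: "'k::field_char_0 alg \<Rightarrow> 'v::ab_group_add \<Rightarrow> 'v"
  assumes irr: "irreducible_module V act"
    and ab: "a \<in> {1, -1}" "b \<in> {1, -1}"
    and lad: "ladder V act (scalar a * gen_alg Gx) (scalar b * gen_alg Gy)
      (scalar (a * b) * gen_alg Gz) (2 * d + 1) (of_nat (2 * d + 1)) u"
    and top: "u (2 * d + 2) = 0" and nz: "u 0 + u (2 * d + 1) \<noteq> 0"
  obtains n where "module_isomorphic V act (type_space (TypeAB d n)) (type_act (TypeAB d n))"
proof -
  interpret ladder V act "scalar a * gen_alg Gx" "scalar b * gen_alg Gy" "scalar (a * b) * gen_alg Gz"
    "2 * d + 1" "of_nat (2 * d + 1)" u by (rule lad)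
  \<comment> \<open>The type AB formulas carry (-1)^d on x and y but not on z. The label absorbs
    both factors, and they cancel in the sign of z.\<close>
  have "a * (-1) ^ d \<in> {1, -1}" "b * (-1) ^ d \<in> {1, -1}"
    using ab by (cases "even d"; auto)+
  then obtain n where n: "label_sign Gx n = a * (-1) ^ d" "label_sign Gy n = b * (-1) ^ d"
    by (rule label_with_signs)
  have "module_isomorphic V act (type_space (TypeAB d n)) (type_act (TypeAB d n))"
  proof (rule ladder.isomorphic_type_AB[OF ladder_fold[OF lad top] irr])
    show "scalar a * gen_alg Gx = scalar (label_sign Gx n * (-1) ^ d) * gen_alg Gx"
      "scalar b * gen_alg Gy = scalar (label_sign Gy n * (-1) ^ d) * gen_alg Gy"
      by (simp_all add: n mult.assoc minus_one_power_square)
    have "label_sign Gz n = a * b"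
      unfolding label_sign_simps(1) n by (cases "even d") simp_all
    then show "scalar (a * b) * gen_alg Gz = scalar (label_sign Gz n) * gen_alg Gz"
      by simp
    show "u 0 + u (2 * d + 1 - 0) \<noteq> 0" using nz by simp
    \<comment> \<open>The reflection exchanges \<open>d\<close> and \<open>d + 1\<close>, so the
      folded vectors at these two indices agree.\<close>
    have "2 * d + 1 - Suc d = d" "2 * d + 1 - d = Suc d" by simp_all
    then show "u (Suc d) + u (2 * d + 1 - Suc d) = u d + u (2 * d + 1 - d)"
      by (simp only: add.commute)
  qed (rule refl)
  then show thesis by (rule that)
qed

lemma listed_type_exists:
  fixes V :: "'v::ab_group_add set"
    and act :: "'k::{alg_closed_field, field_char_0} alg \<Rightarrow> 'v \<Rightarrow> 'v"
  assumes irr: "irreducible_module V act"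
    and fd: "finite_dimensional_module V act"
  obtains t where "t \<in> listed_types" "module_isomorphic V act (type_space t) (type_act t)"
proof -
  interpret left_module V act using irr by (simp add: irreducible_module_def)
  interpret finite_dimensional_alg_module V act by unfold_locales (rule fd)
  let ?x = "gen_alg Gx :: 'k alg" and ?y = "gen_alg Gy :: 'k alg" and ?z = "gen_alg Gz :: 'k alg"
  interpret S: finite_dimensional_spin_module V act ?x ?y ?z
    by (intro finite_dimensional_spin_module.intro spin_module.intro spin_triple_gen) unfold_locales
  obtain v where "v \<in> V" "v \<noteq> 0"
    using irr zero_closed unfolding irreducible_module_def by blast
  then obtain v' c where "v' \<in> V" "v' \<noteq> 0" "act ?x v' = scale c v'"
    using eigenvector_exists[OF alg_closed_imp_poly_has_root, of v ?x] by metis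
  then obtain w l m where w: "w \<in> V" "w \<noteq> 0" "act ?x w = scale l w" "act (S.step m) w = 0"
    by (rule S.step_annihilates_some_eigenvector)
  \<comment> \<open>For odd \<open>m\<close> the vector \<open>w\<close> is killed by y - z. For
    even \<open>m\<close> it is killed by y + z, and negating x and z turns this into the first
    case.\<close>
  define a :: 'k where "a = (if odd m then 1 else -1)"
  have a: "a \<in> {1, -1}" "a * a = 1" by (auto simp: a_def)
  interpret T: finite_dimensional_spin_module V act "scalar a * ?x" "scalar 1 * ?y" "scalar (a * 1) * ?z"
    by (intro finite_dimensional_spin_module.intro spin_module.intro spin_triple_signs)
      (use a in \<open>simp_all add: alg_module_axioms finite_dimensional_alg_module_axioms\<close>)
  have T_step: "T.step i = (if odd m then S.step i else S.step (Suc i))" for i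
    unfolding T.step_def S.step_def by (simp add: a_def scalar_1 scalar_uminus)
  have step_m: "S.step m = T.step 1"
    unfolding T_step by (auto intro: S.step_cong)
  have "act (scalar a * ?x) w = scale (a * l) w"
    using w by (simp add: act_scalar_mult scale_simps(4))
  moreover have "act (T.step 1) w = 0"
    using w(4) unfolding step_m .
  ultimately obtain N u where N: "a * l = of_nat N" and u0: "u 0 = w" "u N \<noteq> 0" "u (Suc N) = 0"
    and lad: "ladder V act (scalar a * ?x) (scalar 1 * ?y) (scalar (a * 1) * ?z) N (a * l) u"
    using T.finite_ladder[OF w(1,2)] by metis
  interpret T: ladder V act "scalar a * ?x" "scalar 1 * ?y" "scalar (a * 1) * ?z" N "a * l" u
    by (rule lad)
  show thesis
  proof (cases "even N")
    case True
    \<comment> \<open>For even \<open>N\<close> the sign change is undone: the top of a ladder for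
      -x, y, -z can serve as the bottom of one for x, y, z.\<close>
    have "\<exists>v\<in>V. v \<noteq> 0 \<and> act ?x v = scale (of_nat N) v \<and> act (S.step 1) v = 0"
    proof (cases "odd m")
      case True
      then have "S.step 1 = S.step m" by (intro S.step_cong) simp
      then show ?thesis using w N True by (intro bexI[of _ w]) (simp_all add: a_def)
    next
      case False
      have "act (scalar a * ?x) (u N) = scale (- of_nat N) (u N)"
        using T.act_X[of N] \<open>even N\<close> by (simp add: N)
      then have "act ?x (u N) = scale (of_nat N) (u N)"
        using False T.u_closed[of N]
        by (simp add: a_def scalar_1 scalar_uminus act_uminus_left scale_uminus_left)
      moreover have "act (S.step 1) (u N) = 0"
      proof -
        have "act (T.step N) (u N) = 0"
          using T.step_up[of N] u0 by (simp add: scale_simps(3))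
        moreover have "T.step N = S.step 1"
          using False \<open>even N\<close> unfolding T_step by (auto intro: S.step_cong)
        ultimately show ?thesis by simp
      qed
      ultimately show ?thesis using u0 T.u_closed[of N] by (intro bexI[of _ "u N"]) auto
    qed
    then obtain v where v: "v \<in> V" "v \<noteq> 0" "act ?x v = scale (of_nat N) v" "act (S.step 1) v = 0"
      by blast
    obtain N' u' where "(of_nat N :: 'k) = of_nat N'" "ladder V act ?x ?y ?z N' (of_nat N) u'"
      "u' 0 = v" "u' (Suc N') = 0"
      using S.finite_ladder[OF v] by metis
    then have "module_isomorphic V act (type_space (TypeB N)) (type_act (TypeB N))"
      using True v by (intro ladder.isomorphic_type_B[OF _ irr, where u = u']) auto
    with True show thesis by (intro that[of "TypeB N"]) (auto simp: listed_types_def)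
  next
    case False
    then obtain d where d: "N = 2 * d + 1" by (elim oddE)
    show thesis
    \<comment> \<open>If the folded bottom vector vanishes, the alternated ladder is folded instead;
      its bottom vector is \<open>u 0 - u N\<close>, which then equals twice
      \<open>u 0\<close>.\<close>
    proof (cases "u 0 + u N = 0")
      case nz: False
      obtain n where "module_isomorphic V act (type_space (TypeAB d n)) (type_act (TypeAB d n))"
        by (rule odd_ladder_isomorphic_type_AB[OF irr a(1) _ lad[unfolded N, unfolded d]])
          (use nz u0 d in simp_all)
      then show thesis by (intro that[of "TypeAB d n"]) (auto simp: listed_types_def)
    next
      case zero: True
      let ?u = "\<lambda>i. scale ((-1) ^ i) (u i)"
      have "ladder V act (scalar a * ?x) (scalar (-1) * ?y) (scalar (a * -1) * ?z) N (of_nat N) ?u"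
        using T.ladder_alternate by (simp add: N scalar_uminus scalar_1)
      note lad' = this[unfolded d]
      have uN: "u N = - u 0" using zero by (simp add: eq_neg_iff_add_eq_0 add.commute)
      have "scale 2 (u 0) \<noteq> 0" using w u0 by (simp add: scale_eq_0_iff)
      moreover have "scale 2 (u 0) = u 0 + u 0"
        using w u0 scale_add_left[of "u 0" 1 1] by (simp add: scale_simps)
      ultimately have "?u 0 + ?u (2 * d + 1) \<noteq> 0"
        using w u0 uN by (simp add: d scale_simps scale_uminus_left uminus_closed)
      moreover have "?u (2 * d + 2) = 0" using u0 by (simp add: d scale_simps)
      ultimately obtain n where "module_isomorphic V act (type_space (TypeAB d n)) (type_act (TypeAB d n))"
        using odd_ladder_isomorphic_type_AB[OF irr a(1) _ lad'] by blast
      then show thesis by (intro that[of "TypeAB d n"]) (auto simp: listed_types_def)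
    qed
  qed
qed

theorem theorem3p20:
  fixes V :: "'v::ab_group_add set"
    and act :: "'k::{alg_closed_field, field_char_0} alg \<Rightarrow> 'v \<Rightarrow> 'v"
  assumes "irreducible_module V act"
    and "finite_dimensional_module V act"
  shows "\<exists>!t. t \<in> listed_types \<and> module_isomorphic V act (type_space t) (type_act t)"
proof -
  have V: "left_module V act" using assms(1) by (simp add: irreducible_module_def)
  obtain t where t: "t \<in> listed_types" "module_isomorphic V act (type_space t) (type_act t)"
    using listed_type_exists[OF assms] .
  show ?thesis
  proof (rule ex1I)
    fix t' assume t': "t' \<in> listed_types \<and> module_isomorphic V act (type_space t') (type_act t')"
    then have "module_isomorphic (type_space t' :: 'k vec set) (type_act t') (type_space t) (type_act t)"
      using module_isomorphic_trans[OF module_isomorphic_sym[OF V] t(2)] by blast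
    then show "t' = t" using t(1) t' by (intro listed_type_unique) auto
  qed (use t in blast)
qed

end
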